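(* Consider the time-optimal problem on the Cartan group $M$ described in the context. (i) Every optimal abnormal control has the form $$u(t)\equiv \mathrm{const},\qquad \|u(t)\|_\infty\equiv 1,$$ and all controls of this form are optimal (and are abnormal controls). (ii) These controls define an optimal synthesis on the abnormal manifold $A$ of the distribution $\mathrm{span}(X_1,X_2)$ (i.e. every point of $A$ is reached from $\mathrm{Id}$ by an optimal trajectory with such a control, these trajectories staying in $A$), where $$A=\{e^{(u_1X_1+u_2X_2)}(\mathrm{Id})\mid u_1,u_2\in\mathbb R\}=\Big\{(x,y,z,v,w)\in M\ \Big|\ z=0,\ v=\tfrac{y(x^2+y^2)}{6},\ w=-\tfrac{x(x^2+y^2)}{6}\Big\}.$$ (iii) Optimal abnormal trajectories are (restrictions to $[0,T]$ of) one-parameter subgroups of $M$ tangent to the distribution $\mathrm{span}(X_1,X_2)$, and their projections to the plane $(x,y)$ lie on straight lines.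
   Context: Let $M=\mathbb R^5$ with coordinates $(x,y,z,v,w)$, and let $X_1=\partial_x-\frac y2\partial_z-\frac{x^2+y^2}{2}\partial_w$, $X_2=\partial_y+\frac x2\partial_z+\frac{x^2+y^2}{2}\partial_v$, $X_3=\partial_z+x\partial_v+y\partial_w$, $X_4=\partial_v$, $X_5=\partial_w$. The nonzero brackets are $[X_1,X_2]=X_3$, $[X_1,X_3]=X_4$, $[X_2,X_3]=X_5$. $M$ is the Cartan group: the connected simply connected Lie group with identity $\mathrm{Id}=(0,\dots,0)$ for which $X_1,\dots,X_5$ are left-invariant and span the Lie algebra. $e^{X}(\mathrm{Id})$ is the time-one flow of the vector field $X$ from $\mathrm{Id}$. Time-optimal problem: $\dot q=u_1X_1(q)+u_2X_2(q)$, $u=(u_1,u_2)$ measurable with values in $U=\{u\in\mathbb R^2:\|u\|_\infty=\max(|u_1|,|u_2|)\le 1\}$, $q(0)=\mathrm{Id}$, $q(T)=q_1$, $T\to\min$. A control on $[0,T]$ and its trajectory from $\mathrm{Id}$ are optimal if no admissible control steers $\mathrm{Id}$ to $q(T)$ in time less than $T$. Equalities of controls are understood for a.e. $t$. For $\lambda\in T^*M$ set $h_i(\lambda)=\langle\lambda,X_i\rangle$, $i=1,\dots,5$, and $H=|h_1|+|h_2|$. An extremal is a Lipschitz curve $\lambda_t\in T^*_{q(t)}M$, $\lambda_t\neq0$, $t\in[0,T]$, together with an admissible control $u$ and a number $\nu\le0$ such that $\dot\lambda_t=u_1\vec h_1(\lambda_t)+u_2\vec h_2(\lambda_t)$ ($\vec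 h_i$ the Hamiltonian vector field of $h_i$), i.e. in coordinates $\dot h_1=-u_2h_3$, $\dot h_2=u_1h_3$, $\dot h_3=u_1h_4+u_2h_5$, $\dot h_4=\dot h_5=0$, $\dot q=u_1X_1+u_2X_2$; $u_1(t)h_1(\lambda_t)+u_2(t)h_2(\lambda_t)=\max_{v\in U}(v_1h_1+v_2h_2)(\lambda_t)=H(\lambda_t)$; and $H(\lambda_t)+\nu\equiv0$. The extremal is abnormal if $\nu=0$ (equivalently $H(\lambda_t)\equiv 0$). A control and its trajectory are called abnormal if they admit an abnormal extremal. *)

theory Defs
  imports "HOL-Analysis.Analysis"
begin

section \<open>The Cartan group\<close>

text \<open>Points are \<open>(x, y, z, v, w)\<close>; tangent vectors and covectors are written in the same
  coordinates. The identity element is \<open>0\<close>.\<close>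

type_synonym M = "real \<times> real \<times> real \<times> real \<times> real"

fun X1 :: "M \<Rightarrow> M" where
  "X1 (x, y, z, v, w) = (1, 0, - y / 2, 0, - (x\<^sup>2 + y\<^sup>2) / 2)"

fun X2 :: "M \<Rightarrow> M" where
  "X2 (x, y, z, v, w) = (0, 1, x / 2, (x\<^sup>2 + y\<^sup>2) / 2, 0)"

fun X3 :: "M \<Rightarrow> M" where
  "X3 (x, y, z, v, w) = (0, 0, 1, x, y)"

fun X4 :: "M \<Rightarrow> M" where
  "X4 (x, y, z, v, w) = (0, 0, 0, 1, 0)"

fun X5 :: "M \<Rightarrow> M" where
  "X5 (x, y, z, v, w) = (0, 0, 0, 0, 1)"

definition distribution :: "M \<Rightarrow> M set" where
  "distribution q = span {X1 q, X2 q}"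

text \<open>The polynomial group law making \<open>X1, \<dots>, X5\<close> left-invariant with identity \<open>0\<close>;
  the lemmas below verify this and show that these requirements determine it.\<close>

fun cartan_mult :: "M \<Rightarrow> M \<Rightarrow> M" where
  "cartan_mult (a, b, c, d, e) (x, y, z, v, w) =
     (a + x,
      b + y,
      c + z + (a * y - b * x) / 2,
      d + v + a * z + a * x * y / 2 + (a\<^sup>2 + b\<^sup>2) * y / 2 + b * y\<^sup>2 / 2,
      e + w + b * z - b * x * y / 2 - (a\<^sup>2 + b\<^sup>2) * x / 2 - a * x\<^sup>2 / 2)"

fun cartan_inv :: "M \<Rightarrow> M" where
  "cartan_inv (a, b, c, d, e) = (- a, - b, - c, - d + a * c, - e + b * c)"

definition left_invariant :: "(M \<Rightarrow> M \<Rightarrow> M) \<Rightarrow> (M \<Rightarrow> M) \<Rightarrow> bool" where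
  "left_invariant m X \<longleftrightarrow>
     (\<forall>g q. \<exists>D. (m g has_derivative D) (at q) \<and> D (X q) = X (m g q))"

lemma group_cartan: "group cartan_mult 0 cartan_inv"
proof unfold_locales
  fix p q r :: M
  show "cartan_mult (cartan_mult p q) r = cartan_mult p (cartan_mult q r)"
    by (cases p rule: prod_cases5; cases q rule: prod_cases5; cases r rule: prod_cases5)
       (simp add: field_simps power2_eq_square)
  show "cartan_mult 0 p = p"
    by (cases p rule: prod_cases5) (simp add: zero_prod_def)
  show "cartan_mult (cartan_inv p) p = 0"
    by (cases p rule: prod_cases5)
       (simp add: zero_prod_def field_simps power2_eq_square)
qed


lemma X_alt:
  "X1 = (\<lambda>q. (1, 0, - fst (snd q) / 2, 0, - ((fst q)\<^sup>2 + (fst (snd q))\<^sup>2) / 2))"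
  "X2 = (\<lambda>q. (0, 1, fst q / 2, ((fst q)\<^sup>2 + (fst (snd q))\<^sup>2) / 2, 0))"
  "X3 = (\<lambda>q. (0, 0, 1, fst q, fst (snd q)))"
  "X4 = (\<lambda>q. (0, 0, 0, 1, 0))"
  "X5 = (\<lambda>q. (0, 0, 0, 0, 1))"
  by (auto simp: fun_eq_iff)

lemma cartan_mult_alt:
  "cartan_mult (a, b, c, d, e) = (\<lambda>q.
     (a + fst q,
      b + fst (snd q),
      c + fst (snd (snd q)) + (a * fst (snd q) - b * fst q) / 2,
      d + fst (snd (snd (snd q))) + a * fst (snd (snd q)) + a * fst q * fst (snd q) / 2
        + (a\<^sup>2 + b\<^sup>2) * fst (snd q) / 2 + b * (fst (snd q))\<^sup>2 / 2,
      e + snd (snd (snd (snd q))) + b * fst (snd (snd q)) - b * fst q * fst (snd q) / 2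
        - (a\<^sup>2 + b\<^sup>2) * fst q / 2 - a * (fst q)\<^sup>2 / 2))"
  by (auto simp: fun_eq_iff)

lemma left_invariant_cartan_mult:
  assumes "X \<in> {X1, X2, X3, X4, X5}"
  shows "left_invariant cartan_mult X"
  unfolding left_invariant_def
proof (intro allI)
  fix g q :: M
  obtain a b c d e where g: "g = (a, b, c, d, e)" by (cases g rule: prod_cases5)
  show "\<exists>D. (cartan_mult g has_derivative D) (at q) \<and> D (X q) = X (cartan_mult g q)"
    unfolding g cartan_mult_alt
    apply (rule exI, rule conjI)
     apply (auto intro!: derivative_eq_intros)[1]
    using assms
    apply (cases q rule: prod_cases5)
    apply (auto simp: X_alt field_simps power2_eq_square)
    done
qed

lemma left_invariant_frame_derivative:
  assumes "\<And>X. X \<in> {X1, X2, X3, X4, X5} \<Longrightarrow> left_invariant m X"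
  shows "(m g has_derivative (\<lambda>(dx, dy, dz, dv, dw).
     let (x, y, z, v, w) = q; r = (x\<^sup>2 + y\<^sup>2) / 2; c = dz + (y * dx - x * dy) / 2 in
     dx *\<^sub>R X1 (m g q) + dy *\<^sub>R X2 (m g q) + c *\<^sub>R X3 (m g q)
       + (dv - r * dy - c * x) *\<^sub>R X4 (m g q)
       + (dw + r * dx - c * y) *\<^sub>R X5 (m g q))) (at q)"
proof -
  obtain D where D: "(m g has_derivative D) (at q)"
    using assms[of X1] unfolding left_invariant_def by blast
  have DX: "D (X q) = X (m g q)" if X: "X \<in> {X1, X2, X3, X4, X5}" for X
  proof -
    obtain D' where D': "(m g has_derivative D') (at q)" "D' (X q) = X (m g q)"
      using assms[OF X] unfolding left_invariant_def by blast
    then show ?thesis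
      using has_derivative_unique[OF D D'(1)] by simp
  qed
  have lin: "linear D"
    using D has_derivative_linear by blast
  obtain x y z v w where q: "q = (x, y, z, v, w)" by (cases q rule: prod_cases5)
  have "D (dx, dy, dz, dv, dw) =
      (let r = (x\<^sup>2 + y\<^sup>2) / 2; c = dz + (y * dx - x * dy) / 2 in
      dx *\<^sub>R X1 (m g q) + dy *\<^sub>R X2 (m g q) + c *\<^sub>R X3 (m g q)
       + (dv - r * dy - c * x) *\<^sub>R X4 (m g q)
       + (dw + r * dx - c * y) *\<^sub>R X5 (m g q))" for dx dy dz dv dw
  proof -
    define r where "r = (x\<^sup>2 + y\<^sup>2) / 2"
    define c where "c = dz + (y * dx - x * dy) / 2"
    have "(dx, dy, dz, dv, dw) = dx *\<^sub>R X1 q + dy *\<^sub>R X2 q + c *\<^sub>R X3 q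
       + (dv - r * dy - c * x) *\<^sub>R X4 q + (dw + r * dx - c * y) *\<^sub>R X5 q"
      by (simp add: q r_def c_def field_simps)
    then show ?thesis
      by (simp add: linear_add[OF lin] linear_scale[OF lin] DX r_def[symmetric] c_def[symmetric]
          Let_def)
  qed
  then have "D = (\<lambda>(dx, dy, dz, dv, dw).
     let (x, y, z, v, w) = q; r = (x\<^sup>2 + y\<^sup>2) / 2; c = dz + (y * dx - x * dy) / 2 in
     dx *\<^sub>R X1 (m g q) + dy *\<^sub>R X2 (m g q) + c *\<^sub>R X3 (m g q)
       + (dv - r * dy - c * x) *\<^sub>R X4 (m g q)
       + (dw + r * dx - c * y) *\<^sub>R X5 (m g q))"
    by (auto simp: fun_eq_iff q)
  with D show ?thesis by simp
qed

lemma eq_if_same_derivative: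
  fixes f g :: "M \<Rightarrow> real"
  assumes "\<And>q. (f has_derivative D q) (at q)" "\<And>q. (g has_derivative D q) (at q)" "f 0 = g 0"
  shows "f = g"
proof -
  have "((\<lambda>q. f q - g q) has_derivative (\<lambda>_. 0)) (at q)" for q
    using has_derivative_diff[OF assms(1)[of q] assms(2)[of q]] by simp
  then obtain c where "\<And>q. f q - g q = c"
    using has_derivative_zero_constant[of UNIV "\<lambda>q. f q - g q"] by auto
  then show ?thesis using assms(3) by (metis diff_self eq_iff_diff_eq_0 ext)
qed

lemma cartan_mult_unique:
  assumes inv: "\<And>X. X \<in> {X1, X2, X3, X4, X5} \<Longrightarrow> left_invariant m X"
    and one: "\<And>g. m g 0 = g"
  shows "m = cartan_mult"
proof
  fix g
  let ?G = "cartan_mult g"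
  have one': "m g 0 = ?G 0"
    unfolding one by (cases g rule: prod_cases5) (simp add: zero_prod_def)
  note dF = left_invariant_frame_derivative[of m g, OF inv]
  note dG = left_invariant_frame_derivative[of cartan_mult g, OF left_invariant_cartan_mult]
  let ?p1 = "\<lambda>q::M. fst q"
  let ?p2 = "\<lambda>q::M. fst (snd q)"
  let ?p3 = "\<lambda>q::M. fst (snd (snd q))"
  let ?p4 = "\<lambda>q::M. fst (snd (snd (snd q)))"
  let ?p5 = "\<lambda>q::M. snd (snd (snd (snd q)))"
  have 1: "(\<lambda>q. ?p1 (m g q)) = (\<lambda>q. ?p1 (?G q))"
    by (rule eq_if_same_derivative[OF
          has_derivative_fst[OF dF]
          has_derivative_eq_rhs[OF has_derivative_fst[OF dG]]])
       (auto simp: X_alt Let_def split_beta one')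
  have 2: "(\<lambda>q. ?p2 (m g q)) = (\<lambda>q. ?p2 (?G q))"
    by (rule eq_if_same_derivative[OF
          has_derivative_fst[OF has_derivative_snd[OF dF]]
          has_derivative_eq_rhs[OF has_derivative_fst[OF has_derivative_snd[OF dG]]]])
       (auto simp: X_alt Let_def split_beta one')
  have 12: "?p1 (m g q) = ?p1 (?G q)" "?p2 (m g q) = ?p2 (?G q)" for q
    using fun_cong[OF 1] fun_cong[OF 2] by simp_all
  have 3: "(\<lambda>q. ?p3 (m g q)) = (\<lambda>q. ?p3 (?G q))"
    by (rule eq_if_same_derivative[OF
          has_derivative_fst[OF has_derivative_snd[OF has_derivative_snd[OF dF]]]
          has_derivative_eq_rhs[OF has_derivative_fst[OF has_derivative_snd[OF has_derivative_snd[OF dG]]]]])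
       (auto simp: X_alt Let_def split_beta one' 12)
  have 4: "(\<lambda>q. ?p4 (m g q)) = (\<lambda>q. ?p4 (?G q))"
    by (rule eq_if_same_derivative[OF
          has_derivative_fst[OF has_derivative_snd[OF has_derivative_snd[OF has_derivative_snd[OF dF]]]]
          has_derivative_eq_rhs[OF has_derivative_fst[OF has_derivative_snd[OF has_derivative_snd[OF has_derivative_snd[OF dG]]]]]])
       (auto simp: X_alt Let_def split_beta one' 12)
  have 5: "(\<lambda>q. ?p5 (m g q)) = (\<lambda>q. ?p5 (?G q))"
    by (rule eq_if_same_derivative[OF
          has_derivative_snd[OF has_derivative_snd[OF has_derivative_snd[OF has_derivative_snd[OF dF]]]]
          has_derivative_eq_rhs[OF has_derivative_snd[OF has_derivative_snd[OF has_derivative_snd[OF has_derivative_snd[OF dG]]]]]])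
       (auto simp: X_alt Let_def split_beta one' 12)
  show "m g = ?G"
  proof
    show "m g q = ?G q" for q
      using fun_cong[OF 1, of q] fun_cong[OF 2, of q] fun_cong[OF 3, of q] fun_cong[OF 4, of q]
        fun_cong[OF 5, of q]
      by (intro prod_eqI) simp_all
  qed
qed

text \<open>Smooth homomorphisms from the additive group of the reals.\<close>

definition smooth_curve :: "(real \<Rightarrow> M) \<Rightarrow> bool" where
  "smooth_curve \<gamma> \<longleftrightarrow>
     (\<exists>D. D 0 = \<gamma> \<and> (\<forall>n t. (D n has_vector_derivative D (Suc n) t) (at t)))"

definition one_parameter_subgroup :: "(real \<Rightarrow> M) \<Rightarrow> bool" where
  "one_parameter_subgroup \<gamma> \<longleftrightarrow>
     smooth_curve \<gamma> \<and> (\<forall>s t. \<gamma> (s + t) = cartan_mult (\<gamma> s) (\<gamma> t))"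

definition tangent_to_distribution :: "(real \<Rightarrow> M) \<Rightarrow> bool" where
  "tangent_to_distribution \<gamma> \<longleftrightarrow>
     (\<forall>t. \<exists>D \<in> distribution (\<gamma> t). (\<gamma> has_vector_derivative D) (at t))"

definition time_one_flow :: "(M \<Rightarrow> M) \<Rightarrow> M \<Rightarrow> M" where
  "time_one_flow X p = (THE q. \<exists>\<gamma>. \<gamma> 0 = p \<and> \<gamma> 1 = q \<and>
     (\<forall>t \<in> {0..1}. (\<gamma> has_vector_derivative X (\<gamma> t)) (at t within {0..1})))"

definition abnormal_manifold :: "M set" where
  "abnormal_manifold = {time_one_flow (\<lambda>q. u\<^sub>1 *\<^sub>R X1 q + u\<^sub>2 *\<^sub>R X2 q) 0 | u\<^sub>1 u\<^sub>2. True}"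


section \<open>The time-optimal problem\<close>

text \<open>Controls \<open>u\<close> are functions on the real line of which only the restriction to
  \<open>{0..T}\<close> matters. The constraint set is the unit ball of the maximum norm.\<close>

lemma infnorm_eq_max: "infnorm (a, b) = max \<bar>a\<bar> \<bar>b\<bar>" for a b :: real
proof -
  have *: "(\<lambda>i. \<bar>(a, b) \<bullet> i\<bar>) ` Basis = {\<bar>a\<bar>, \<bar>b\<bar>}"
    by (simp add: Basis_prod_def insert_commute)
  show ?thesis
    unfolding infnorm_def Setcompr_eq_image * by (simp add: cSup_eq_Max)
qed

definition admissible_control :: "real \<Rightarrow> (real \<Rightarrow> real \<times> real) \<Rightarrow> bool" where
  "admissible_control T u \<longleftrightarrow> 0 \<le> T \<and> u \<in> borel_measurable (lebesgue_on {0..T}) \<and>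
     (\<forall>t \<in> {0..T}. infnorm (u t) \<le> 1)"

definition trajectory :: "real \<Rightarrow> (real \<Rightarrow> real \<times> real) \<Rightarrow> (real \<Rightarrow> M) \<Rightarrow> bool" where
  "trajectory T u q \<longleftrightarrow> admissible_control T u \<and> q 0 = 0 \<and> (\<exists>L. L-lipschitz_on {0..T} q) \<and>
     (AE t in lebesgue_on {0..T}.
        (q has_vector_derivative fst (u t) *\<^sub>R X1 (q t) + snd (u t) *\<^sub>R X2 (q t))
          (at t within {0..T}))"

definition optimal :: "real \<Rightarrow> (real \<Rightarrow> real \<times> real) \<Rightarrow> (real \<Rightarrow> M) \<Rightarrow> bool" where
  "optimal T u q \<longleftrightarrow> trajectory T u q \<and>
     \<not> (\<exists>T' u' q'. T' < T \<and> trajectory T' u' q' \<and> q' T' = q T)"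

definition optimal_control :: "real \<Rightarrow> (real \<Rightarrow> real \<times> real) \<Rightarrow> bool" where
  "optimal_control T u \<longleftrightarrow> (\<exists>q. optimal T u q)"


section \<open>Extremals\<close>

text \<open>Points of the cotangent bundle are pairs \<open>(q, p)\<close> of a point and a covector, the latter
  acting on tangent vectors through the inner product.\<close>

definition momentum :: "(M \<Rightarrow> M) \<Rightarrow> M \<times> M \<Rightarrow> real" where
  "momentum X \<xi> = snd \<xi> \<bullet> X (fst \<xi>)"

text \<open>In canonical coordinates: \<open>(\<partial>F/\<partial>p, - \<partial>F/\<partial>q)\<close>.\<close>

definition hamiltonian_field :: "(M \<times> M \<Rightarrow> real) \<Rightarrow> M \<times> M \<Rightarrow> M \<times> M" where
  "hamiltonian_field F \<xi> =
     (\<Sum>b\<in>Basis. frechet_derivative F (at \<xi>) (0, b) *\<^sub>R b,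
      - (\<Sum>b\<in>Basis. frechet_derivative F (at \<xi>) (b, 0) *\<^sub>R b))"

definition max_hamiltonian :: "M \<times> M \<Rightarrow> real" where
  "max_hamiltonian \<xi> = \<bar>momentum X1 \<xi>\<bar> + \<bar>momentum X2 \<xi>\<bar>"

definition extremal ::
  "real \<Rightarrow> (real \<Rightarrow> real \<times> real) \<Rightarrow> (real \<Rightarrow> M) \<Rightarrow> (real \<Rightarrow> M \<times> M) \<Rightarrow> real \<Rightarrow> bool" where
  "extremal T u q \<xi> \<nu> \<longleftrightarrow>
     admissible_control T u \<and> \<nu> \<le> 0 \<and>
     (\<exists>L. L-lipschitz_on {0..T} \<xi>) \<and>
     (\<forall>t \<in> {0..T}. fst (\<xi> t) = q t \<and> snd (\<xi> t) \<noteq> 0) \<and>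
     (AE t in lebesgue_on {0..T}.
        (\<xi> has_vector_derivative
           fst (u t) *\<^sub>R hamiltonian_field (momentum X1) (\<xi> t) +
           snd (u t) *\<^sub>R hamiltonian_field (momentum X2) (\<xi> t)) (at t within {0..T})) \<and>
     (AE t in lebesgue_on {0..T}.
        fst (u t) * momentum X1 (\<xi> t) + snd (u t) * momentum X2 (\<xi> t) = max_hamiltonian (\<xi> t) \<and>
        (\<forall>v. infnorm v \<le> 1 \<longrightarrow>
           fst v * momentum X1 (\<xi> t) + snd v * momentum X2 (\<xi> t) \<le> max_hamiltonian (\<xi> t))) \<and>
     (\<forall>t \<in> {0..T}. max_hamiltonian (\<xi> t) + \<nu> = 0)"

definition abnormal :: "real \<Rightarrow> (real \<Rightarrow> real \<times> real) \<Rightarrow> (real \<Rightarrow> M) \<Rightarrow> bool" where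
  "abnormal T u q \<longleftrightarrow> trajectory T u q \<and> (\<exists>\<xi>. extremal T u q \<xi> 0)"

definition abnormal_control :: "real \<Rightarrow> (real \<Rightarrow> real \<times> real) \<Rightarrow> bool" where
  "abnormal_control T u \<longleftrightarrow> (\<exists>q. abnormal T u q)"

definition unit_constant_control :: "real \<Rightarrow> (real \<Rightarrow> real \<times> real) \<Rightarrow> bool" where
  "unit_constant_control T u \<longleftrightarrow> admissible_control T u \<and>
     (\<exists>c. infnorm c = 1 \<and> (AE t in lebesgue_on {0..T}. u t = c))"

text \<open>Along a solution of the Hamiltonian equation, the momenta satisfy the familiar system; this
  fixes the sign conventions and reflects the brackets \<open>[X1, X2] = X3\<close>, \<open>[X1, X3] = X4\<close>,
  \<open>[X2, X3] = X5\<close>.\<close>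

lemma hamiltonian_field_eqI:
  assumes "(F has_derivative (\<lambda>(dq, dp). a \<bullet> dp - b \<bullet> dq)) (at \<xi>)"
  shows "hamiltonian_field F \<xi> = (a, b)"
proof -
  have "frechet_derivative F (at \<xi>) = (\<lambda>(dq, dp). a \<bullet> dp - b \<bullet> dq)"
    using frechet_derivative_at[OF assms] by simp
  then show ?thesis
    by (simp add: hamiltonian_field_def sum_negf euclidean_representation)
qed

lemma momentum_alt:
  "momentum X1 (q, p) = fst p - fst (snd (snd p)) * fst (snd q) / 2
     - snd (snd (snd (snd p))) * ((fst q)\<^sup>2 + (fst (snd q))\<^sup>2) / 2"
  "momentum X2 (q, p) = fst (snd p) + fst (snd (snd p)) * fst q / 2
     + fst (snd (snd (snd p))) * ((fst q)\<^sup>2 + (fst (snd q))\<^sup>2) / 2"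
  "momentum X3 (q, p) = fst (snd (snd p)) + fst (snd (snd (snd p))) * fst q
     + snd (snd (snd (snd p))) * fst (snd q)"
  "momentum X4 (q, p) = fst (snd (snd (snd p)))"
  "momentum X5 (q, p) = snd (snd (snd (snd p)))"
  by (simp_all add: momentum_def X_alt inner_prod_def field_simps)

lemma has_derivative_momentum_12:
  "(momentum X1 has_derivative (\<lambda>(dq, dp).
     X1 q \<bullet> dp - (snd (snd (snd (snd p))) * fst q,
       fst (snd (snd p)) / 2 + snd (snd (snd (snd p))) * fst (snd q), 0, 0, 0) \<bullet> dq)) (at (q, p))"
  (is "(_ has_derivative ?D1) _")
  "(momentum X2 has_derivative (\<lambda>(dq, dp).
     X2 q \<bullet> dp - (- fst (snd (snd p)) / 2 - fst (snd (snd (snd p))) * fst q,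
       - fst (snd (snd (snd p))) * fst (snd q), 0, 0, 0) \<bullet> dq)) (at (q, p))"
  (is "(_ has_derivative ?D2) _")
proof -
  have eq: "momentum X = (\<lambda>\<xi>. momentum X (fst \<xi>, snd \<xi>))" for X by simp
  have "((\<lambda>\<xi>. momentum X1 (fst \<xi>, snd \<xi>)) has_derivative ?D1) (at (q, p))"
    unfolding momentum_alt
    by (rule has_derivative_eq_rhs, (rule derivative_intros refl; simp?)+)
       (simp add: fun_eq_iff X_alt split_beta inner_prod_def field_simps power2_eq_square)
  then show "(momentum X1 has_derivative ?D1) (at (q, p))" by (simp add: eq[symmetric])
  have "((\<lambda>\<xi>. momentum X2 (fst \<xi>, snd \<xi>)) has_derivative ?D2) (at (q, p))"
    unfolding momentum_alt
    by (rule has_derivative_eq_rhs, (rule derivative_intros refl; simp?)+)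
       (simp add: fun_eq_iff X_alt split_beta inner_prod_def field_simps power2_eq_square)
  then show "(momentum X2 has_derivative ?D2) (at (q, p))" by (simp add: eq[symmetric])
qed

lemma hamiltonian_field_momentum:
  "hamiltonian_field (momentum X1) (q, p) = (X1 q,
     (snd (snd (snd (snd p))) * fst q,
      fst (snd (snd p)) / 2 + snd (snd (snd (snd p))) * fst (snd q), 0, 0, 0))"
  "hamiltonian_field (momentum X2) (q, p) = (X2 q,
     (- fst (snd (snd p)) / 2 - fst (snd (snd (snd p))) * fst q,
      - fst (snd (snd (snd p))) * fst (snd q), 0, 0, 0))"
  by (rule hamiltonian_field_eqI has_derivative_momentum_12)+

lemma hamiltonian_system:
  assumes "(\<xi> has_vector_derivative
      a *\<^sub>R hamiltonian_field (momentum X1) (\<xi> t) + b *\<^sub>R hamiltonian_field (momentum X2) (\<xi> t))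
      (at t within S)"
  shows "((\<lambda>t. fst (\<xi> t)) has_vector_derivative a *\<^sub>R X1 (fst (\<xi> t)) + b *\<^sub>R X2 (fst (\<xi> t)))
      (at t within S)"
    and "((\<lambda>t. momentum X1 (\<xi> t)) has_real_derivative - b * momentum X3 (\<xi> t)) (at t within S)"
    and "((\<lambda>t. momentum X2 (\<xi> t)) has_real_derivative a * momentum X3 (\<xi> t)) (at t within S)"
    and "((\<lambda>t. momentum X3 (\<xi> t)) has_real_derivative
      a * momentum X4 (\<xi> t) + b * momentum X5 (\<xi> t)) (at t within S)"
    and "((\<lambda>t. momentum X4 (\<xi> t)) has_real_derivative 0) (at t within S)"
    and "((\<lambda>t. momentum X5 (\<xi> t)) has_real_derivative 0) (at t within S)"
proof -
  obtain q p where qp: "\<xi> t = (q, p)" by (cases "\<xi> t")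
  let ?d = "(a *\<^sub>R X1 q + b *\<^sub>R X2 q,
     (a * (snd (snd (snd (snd p))) * fst q)
       + b * (- fst (snd (snd p)) / 2 - fst (snd (snd (snd p))) * fst q),
      a * (fst (snd (snd p)) / 2 + snd (snd (snd (snd p))) * fst (snd q))
       - b * (fst (snd (snd (snd p))) * fst (snd q)), 0::real, 0::real, 0::real))"
  have d: "a *\<^sub>R hamiltonian_field (momentum X1) (\<xi> t)
      + b *\<^sub>R hamiltonian_field (momentum X2) (\<xi> t) = ?d"
    by (simp add: qp hamiltonian_field_momentum)
  have xi: "(\<xi> has_derivative (\<lambda>h. h *\<^sub>R ?d)) (at t within S)"
    using assms unfolding d has_vector_derivative_def .
  note fs = has_derivative_fst[OF xi] has_derivative_snd[OF xi]
  show "((\<lambda>t. fst (\<xi> t)) has_vector_derivative a *\<^sub>R X1 (fst (\<xi> t)) + b *\<^sub>R X2 (fst (\<xi> t)))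
      (at t within S)"
    using fs(1) by (simp add: has_vector_derivative_def qp)
  have *: "momentum X (\<xi> t) = momentum X (fst (\<xi> t), snd (\<xi> t))" for X t by simp
  show "((\<lambda>t. momentum X1 (\<xi> t)) has_real_derivative - b * momentum X3 (\<xi> t)) (at t within S)"
    unfolding * momentum_alt has_field_derivative_def
    by (rule has_derivative_eq_rhs, (rule derivative_intros fs refl; simp?)+)
       (auto simp: qp fun_eq_iff X_alt field_simps power2_eq_square)
  show "((\<lambda>t. momentum X2 (\<xi> t)) has_real_derivative a * momentum X3 (\<xi> t)) (at t within S)"
    unfolding * momentum_alt has_field_derivative_def
    by (rule has_derivative_eq_rhs, (rule derivative_intros fs refl; simp?)+)
       (auto simp: qp fun_eq_iff X_alt field_simps power2_eq_square)
  show "((\<lambda>t. momentum X3 (\<xi> t)) has_real_derivative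
      a * momentum X4 (\<xi> t) + b * momentum X5 (\<xi> t)) (at t within S)"
    unfolding * momentum_alt has_field_derivative_def
    by (rule has_derivative_eq_rhs, (rule derivative_intros fs refl; simp?)+)
       (auto simp: qp fun_eq_iff X_alt field_simps power2_eq_square)
  show "((\<lambda>t. momentum X4 (\<xi> t)) has_real_derivative 0) (at t within S)"
    unfolding * momentum_alt has_field_derivative_def
    by (rule has_derivative_eq_rhs, (rule derivative_intros fs refl; simp?)+)
       (auto simp: qp fun_eq_iff X_alt field_simps power2_eq_square)
  show "((\<lambda>t. momentum X5 (\<xi> t)) has_real_derivative 0) (at t within S)"
    unfolding * momentum_alt has_field_derivative_def
    by (rule has_derivative_eq_rhs, (rule derivative_intros fs refl; simp?)+)
       (auto simp: qp fun_eq_iff X_alt field_simps power2_eq_square)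
qed

end

theory Submission
  imports Defs
begin

text \<open>
  An abnormal covector has \<open>h\<^sub>1 = h\<^sub>2 = 0\<close>, hence \<open>u\<^sub>1 h\<^sub>3 = u\<^sub>2 h\<^sub>3 = 0\<close> almost everywhere, and so
  \<open>(h\<^sub>3\<^sup>2)' = 2 h\<^sub>3 (u\<^sub>1 h\<^sub>4 + u\<^sub>2 h\<^sub>5) = 0\<close>. If the constant \<open>h\<^sub>3\<^sup>2\<close> is nonzero then \<open>u = 0\<close>, and
  otherwise \<open>u\<close> is orthogonal to the constant nonzero vector \<open>(h\<^sub>4, h\<^sub>5)\<close>. In both cases \<open>u\<close> takes
  values in a line. The curve then projects to a line of the \<open>(x, y)\<close> plane, and its endpoint is the
  time-\<open>infnorm (x, y)\<close> endpoint of a constant control of norm one. Since \<open>\<bar>x\<bar>\<close> and \<open>\<bar>y\<bar>\<close> grow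
  at speed at most one, optimality forces one of them to grow at full speed all the time.

  Lipschitz curves are compared through their almost everywhere derivatives: a Lipschitz function
  maps the exceptional null set to a null set, so some intermediate value avoids its image, and at
  the last point where that value is attained the derivative cannot be negative.
\<close>

section \<open>Monotonicity of Lipschitz functions from the sign of the derivative almost
  everywhere\<close>

lemma lipschitz_ae_nonpos_derivative_antimono:
  fixes f :: "real \<Rightarrow> real"
  assumes lip: "L-lipschitz_on {a..b} f"
    and ae: "AE r in lebesgue_on {a..b}. \<exists>D\<le>0. (f has_real_derivative D) (at r within {a..b})"
    and st: "a \<le> s" "s \<le> t" "t \<le> b"
  shows "f t \<le> f s"
proof (rule ccontr)
  assume "\<not> f t \<le> f s"
  then have lt: "f s < f t" by simp
  with st have "s < t" by (cases "s = t") auto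
  \<comment> \<open>Half the mean slope of \<open>f\<close>. Subtracting \<open>e * r\<close> keeps
    \<open>g s < g t\<close>, while the derivatives of \<open>g\<close> outside the exceptional set
    become strictly negative.\<close>
  define e where "e = ((f t - f s) / 2) / (t - s)"
  have e: "e > 0" "e * (t - s) = (f t - f s) / 2"
    using lt \<open>s < t\<close> nonzero_eq_divide_eq[of "t - s" e "(f t - f s) / 2"] by (simp_all add: e_def)
  define g where "g = (\<lambda>r. f r - e * r)"
  have gst: "g s < g t"
    using e lt by (simp add: g_def algebra_simps)
  have lipg: "(L + \<bar>e\<bar> * 1)-lipschitz_on {a..b} g"
    unfolding g_def by (intro lipschitz_intros lip)
  then have cont: "continuous_on {a..b} g"
    by (rule lipschitz_on_continuous_on)
  define N where "N = {r \<in> {a..b}. \<not> (\<exists>D\<le>0. (f has_real_derivative D) (at r within {a..b}))}"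
  have "AE r in lebesgue. r \<in> {a..b} \<longrightarrow> (\<exists>D\<le>0. (f has_real_derivative D) (at r within {a..b}))"
    using ae by (subst (asm) AE_restrict_space_iff) auto
  then have "negligible N"
    by (simp add: completion.AE_iff_null_sets negligible_iff_null_sets N_def)
  then have "negligible (g ` N)"
  proof (rule negligible_locally_Lipschitz_image[rotated])
    fix x assume "x \<in> N"
    then show "\<exists>T B. open T \<and> x \<in> T \<and> (\<forall>y\<in>N \<inter> T. norm (g y - g x) \<le> B * norm (y - x))"
      using lipschitz_on_normD[OF lipg] by (intro exI[of _ UNIV]) (auto simp: N_def)
  qed simp
  moreover have "\<not> negligible {g s<..<g t}"
    using gst open_not_negligible[of "{g s<..<g t}"] by simp
  ultimately obtain y where y: "g s < y" "y < g t" "y \<notin> g ` N"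
    by (metis greaterThanLessThan_iff negligible_subset subsetI)
  \<comment> \<open>\<open>Sup S\<close> is the last time in \<open>{s..t}\<close> with
    \<open>g\<close> at most \<open>y\<close>; by continuity \<open>g\<close> equals
    \<open>y\<close> there, so this time avoids \<open>N\<close>.\<close>
  define S where "S = {r \<in> {s..t}. g r \<le> y}"
  have conts: "continuous_on {s..t} g"
    using cont st by (rule_tac continuous_on_subset) auto
  have S: "s \<in> S" "bdd_above S" "S \<subseteq> {s..t}"
    using y(1) \<open>s < t\<close> by (auto simp: S_def intro: bdd_aboveI[of _ t])
  have "closed S"
    unfolding S_def using conts by (intro continuous_on_closed_Collect_le) auto
  then have m: "Sup S \<in> S"
    using S closed_contains_Sup by blast
  define m where "m = Sup S"
  have m': "m \<in> {s..t}" "g m \<le> y"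
    using m by (auto simp: S_def m_def)
  have above: "g r > y" if "m < r" "r \<le> t" for r
  proof (rule ccontr)
    assume "\<not> g r > y"
    then have "r \<in> S" using that m'(1) by (simp add: S_def)
    then show False using cSup_upper[OF _ S(2)] \<open>m < r\<close> by (force simp: m_def)
  qed
  have "g m = y"
  proof (rule ccontr)
    assume "g m \<noteq> y"
    with m' obtain r where "m \<le> r" "r \<le> t" "g r = y"
      using IVT'[of g m y t] y continuous_on_subset[OF conts, of "{m..t}"] by auto
    with above[of r] \<open>g m \<noteq> y\<close> show False by (cases "m = r") auto
  qed
  then have "m \<notin> N" using y(3) by auto
  then obtain D where D: "D \<le> 0" "(f has_real_derivative D) (at m within {a..b})"
    using m' st by (auto simp: N_def)
  have "(g has_real_derivative D - e) (at m within {a..b})"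
    unfolding g_def by (auto intro!: derivative_eq_intros D(2))
  then obtain d where d: "d > 0" "\<And>h. h > 0 \<Longrightarrow> m + h \<in> {a..b} \<Longrightarrow> h < d \<Longrightarrow> g (m + h) < g m"
    using has_real_derivative_neg_dec_right[of g "D - e"] D e by force
  have "m < t" using \<open>g m = y\<close> y(2) m'(1) by (cases "m = t") auto
  \<comment> \<open>Halving \<open>d\<close> gives the strict bound \<open>h < d\<close>, and the
    cap \<open>t - m\<close> keeps \<open>m + h\<close> in the range where \<open>g\<close> exceeds
    \<open>y\<close>.\<close>
  define h where "h = min (d / 2) (t - m)"
  have "h > 0" "h < d" "m + h \<le> t"
    using d(1) \<open>m < t\<close> by (auto simp: h_def)
  then show False
    using d(2)[of h] above[of "m + h"] \<open>g m = y\<close> m'(1) st by auto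
qed

section \<open>Closure properties of Lipschitz functions\<close>

text \<open>Hiding the constant lets the closure properties serve as plain introduction
  rules.\<close>

definition lipschitzian_on :: "'a::metric_space set \<Rightarrow> ('a \<Rightarrow> 'b::metric_space) \<Rightarrow> bool" where
  "lipschitzian_on S f \<longleftrightarrow> (\<exists>L. L-lipschitz_on S f)"

lemma lipschitzian_on_const: "lipschitzian_on S (\<lambda>_. c)"
  unfolding lipschitzian_on_def by (blast intro: lipschitz_on_constant)

lemma lipschitzian_on_id: "lipschitzian_on S (\<lambda>x. x)"
  unfolding lipschitzian_on_def by (blast intro: lipschitz_on_id)

lemma lipschitzian_on_Pair:
  "lipschitzian_on S f \<Longrightarrow> lipschitzian_on S g \<Longrightarrow> lipschitzian_on S (\<lambda>x. (f x, g x))"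
  unfolding lipschitzian_on_def by (blast intro: lipschitz_on_Pair)

lemma lipschitzian_on_add:
  fixes f g :: "_ \<Rightarrow> 'b::real_normed_vector"
  shows "lipschitzian_on S f \<Longrightarrow> lipschitzian_on S g \<Longrightarrow> lipschitzian_on S (\<lambda>x. f x + g x)"
  unfolding lipschitzian_on_def by (blast intro: lipschitz_on_add)

lemma lipschitzian_on_diff:
  fixes f g :: "_ \<Rightarrow> 'b::real_normed_vector"
  shows "lipschitzian_on S f \<Longrightarrow> lipschitzian_on S g \<Longrightarrow> lipschitzian_on S (\<lambda>x. f x - g x)"
  unfolding lipschitzian_on_def by (blast intro: lipschitz_on_diff)

lemma lipschitzian_on_bounded_linear:
  assumes "bounded_linear F" "lipschitzian_on S f"
  shows "lipschitzian_on S (\<lambda>x. F (f x))"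
proof -
  obtain L where L: "L-lipschitz_on S f"
    using assms(2) by (auto simp: lipschitzian_on_def)
  obtain B where "B-lipschitz_on (f ` S) F"
    using bounded_linear.lipschitz_boundE[OF assms(1)] .
  then show ?thesis
    using lipschitz_on_compose2[OF L] by (auto simp: lipschitzian_on_def)
qed

lemmas lipschitzian_on_fst = lipschitzian_on_bounded_linear[OF bounded_linear_fst]
  and lipschitzian_on_snd = lipschitzian_on_bounded_linear[OF bounded_linear_snd]

text \<open>Compactness bounds both factors; splitting the increment of the product as in the
  product rule then gives a Lipschitz constant.\<close>

lemma lipschitzian_on_mult:
  fixes f g :: "'a::metric_space \<Rightarrow> real"
  assumes "compact S" "lipschitzian_on S f" "lipschitzian_on S g"
  shows "lipschitzian_on S (\<lambda>x. f x * g x)"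
proof -
  obtain K L where K: "K-lipschitz_on S f" and L: "L-lipschitz_on S g"
    using assms(2,3) by (auto simp: lipschitzian_on_def)
  have "bounded (f ` S)" "bounded (g ` S)"
    using K L assms(1)
    by (auto intro!: compact_imp_bounded compact_continuous_image dest: lipschitz_on_continuous_on)
  then obtain A B where A: "A > 0" "\<And>x. x \<in> S \<Longrightarrow> \<bar>f x\<bar> \<le> A"
    and B: "B > 0" "\<And>x. x \<in> S \<Longrightarrow> \<bar>g x\<bar> \<le> B"
    by (auto simp: bounded_pos)
  have "(A * L + B * K)-lipschitz_on S (\<lambda>x. f x * g x)"
  proof (rule lipschitz_onI)
    fix x y assume xy: "x \<in> S" "y \<in> S"
    have "f x * g x - f y * g y = f x * (g x - g y) + g y * (f x - f y)"
      by (simp add: algebra_simps)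
    then have "\<bar>f x * g x - f y * g y\<bar> \<le> \<bar>f x\<bar> * \<bar>g x - g y\<bar> + \<bar>g y\<bar> * \<bar>f x - f y\<bar>"
      by (metis abs_mult abs_triangle_ineq)
    also have "\<dots> \<le> A * (L * dist x y) + B * (K * dist x y)"
      using A B lipschitz_onD[OF K xy] lipschitz_onD[OF L xy] xy
      by (intro add_mono mult_mono) (auto simp: dist_real_def)
    finally show "dist (f x * g x) (f y * g y) \<le> (A * L + B * K) * dist x y"
      by (simp add: dist_real_def algebra_simps)
  qed (use A B lipschitz_on_nonneg[OF K] lipschitz_on_nonneg[OF L] in simp)
  then show ?thesis
    by (auto simp: lipschitzian_on_def)
qed

lemmas lipschitzian_on_intros = lipschitzian_on_const lipschitzian_on_id lipschitzian_on_Pair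
  lipschitzian_on_add lipschitzian_on_diff lipschitzian_on_fst lipschitzian_on_snd
  lipschitzian_on_mult[OF compact_Icc]

section \<open>Comparison and uniqueness from almost everywhere derivatives\<close>

lemma AE_lebesgue_on_mem: "AE x in lebesgue_on S. x \<in> S"
  by (rule AE_I2) simp

text \<open>The difference \<open>f - g\<close> has nonpositive derivative almost everywhere, so it
  is nonincreasing. This replaces integration of the derivatives throughout.\<close>

lemma ae_derivative_le_imp_increment_le:
  fixes f g :: "real \<Rightarrow> real"
  assumes "lipschitzian_on {a..b} f" "lipschitzian_on {a..b} g"
    and f': "AE r in lebesgue_on {a..b}. (f has_real_derivative f' r) (at r within {a..b})"
    and g': "AE r in lebesgue_on {a..b}. (g has_real_derivative g' r) (at r within {a..b})"
    and le: "AE r in lebesgue_on {a..b}. f' r \<le> g' r"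
    and st: "a \<le> s" "s \<le> t" "t \<le> b"
  shows "f t - f s \<le> g t - g s"
proof -
  obtain L where "L-lipschitz_on {a..b} (\<lambda>r. f r - g r)"
    using lipschitzian_on_diff[OF assms(1,2)] by (auto simp: lipschitzian_on_def)
  moreover have "AE r in lebesgue_on {a..b}. \<exists>D\<le>0.
      ((\<lambda>r. f r - g r) has_real_derivative D) (at r within {a..b})"
    using f' g' le
  proof eventually_elim
    case (elim r)
    then show ?case
      using DERIV_diff[OF elim(1,2)] by (intro exI[of _ "f' r - g' r"]) simp
  qed
  ultimately have "f t - g t \<le> f s - g s"
    using lipschitz_ae_nonpos_derivative_antimono st by blast
  then show ?thesis by simp
qed

text \<open>Each coordinate is compared with the zero function in both directions.\<close>

lemma ae_derivative_zero_imp_constant: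
  fixes f :: "real \<Rightarrow> 'a::euclidean_space"
  assumes lip: "lipschitzian_on {a..b} f"
    and ae: "AE r in lebesgue_on {a..b}. (f has_vector_derivative 0) (at r within {a..b})"
    and t: "t \<in> {a..b}"
  shows "f t = f a"
proof (rule euclidean_eqI)
  fix i :: 'a assume "i \<in> Basis"
  have bl: "bounded_linear (\<lambda>v::'a. v \<bullet> i)"
    by (rule bounded_linear_inner_left)
  have lip': "lipschitzian_on {a..b} (\<lambda>r. f r \<bullet> i)"
    by (rule lipschitzian_on_bounded_linear[OF bl lip])
  have ae': "AE r in lebesgue_on {a..b}. ((\<lambda>r. f r \<bullet> i) has_real_derivative 0) (at r within {a..b})"
    using ae
  proof eventually_elim
    case (elim r)
    then show ?case
      using bounded_linear.has_vector_derivative[OF bl elim]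
      by (simp add: has_real_derivative_iff_has_vector_derivative)
  qed
  note const = lipschitzian_on_const[of "{a..b}" "0::real"]
  have zero: "AE r in lebesgue_on {a..b}. ((\<lambda>_. 0::real) has_real_derivative 0) (at r within {a..b})"
    by simp
  show "f t \<bullet> i = f a \<bullet> i"
    using ae_derivative_le_imp_increment_le[OF lip' const ae' zero, of a t]
      ae_derivative_le_imp_increment_le[OF const lip' zero ae', of a t] t
    by simp
qed

lemma ae_derivative_eq_imp_eq:
  fixes f g :: "real \<Rightarrow> 'a::euclidean_space"
  assumes "lipschitzian_on {a..b} f" "lipschitzian_on {a..b} g" "f a = g a"
    and f': "AE r in lebesgue_on {a..b}. (f has_vector_derivative f' r) (at r within {a..b})"
    and g': "AE r in lebesgue_on {a..b}. (g has_vector_derivative g' r) (at r within {a..b})"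
    and eq: "AE r in lebesgue_on {a..b}. f' r = g' r"
    and t: "t \<in> {a..b}"
  shows "f t = g t"
proof -
  have "AE r in lebesgue_on {a..b}. ((\<lambda>r. f r - g r) has_vector_derivative 0) (at r within {a..b})"
    using f' g' eq
  proof eventually_elim
    case (elim r)
    then show ?case
      using has_vector_derivative_diff[OF elim(1,2)] by simp
  qed
  then have "f t - g t = f a - g a"
    using ae_derivative_zero_imp_constant[OF lipschitzian_on_diff[OF assms(1,2)] _ t] by blast
  then show ?thesis using assms(3) by simp
qed

text \<open>Reads off pointwise consequences from an identity valid on the whole interval: slope 0
  for vanishing momenta, slope 1 for motion at full speed. The condition \<open>a < b\<close>
  excludes a one-point interval, where derivatives are not unique.\<close>

lemma derivative_unique_if_linear:
  fixes f :: "real \<Rightarrow> real"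
  assumes f': "(f has_real_derivative D) (at r within {a..b})" and "a < b" "r \<in> {a..b}"
    and lin: "\<And>t. t \<in> {a..b} \<Longrightarrow> f t = m * t"
  shows "D = m"
proof (rule has_field_derivative_unique)
  show "((\<lambda>t. m * t) has_real_derivative D) (at r within {a..b})"
    using f' zero_less_one assms(3) lin by (rule has_field_derivative_transform_within)
  show "((\<lambda>t. m * t) has_real_derivative m) (at r within {a..b})"
    by (auto intro!: derivative_eq_intros)
  show "at r within {a..b} \<noteq> bot"
    using assms(2,3) by (simp add: trivial_limit_within islimpt_Icc)
qed

text \<open>Comparison of \<open>f\<close> with \<open>t\<close> and with
  \<open>- t\<close>.\<close>

lemma speed_bound:
  fixes f :: "real \<Rightarrow> real"
  assumes lip: "lipschitzian_on {0..T} f" and "f 0 = 0"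
    and f': "AE r in lebesgue_on {0..T}. (f has_real_derivative f' r) (at r within {0..T})"
    and bd: "AE r in lebesgue_on {0..T}. \<bar>f' r\<bar> \<le> 1"
    and t: "t \<in> {0..T}"
  shows "\<bar>f t\<bar> \<le> t"
proof -
  have id': "AE r in lebesgue_on {0..T}. ((\<lambda>r. r) has_real_derivative 1) (at r within {0..T})"
    by simp
  \<comment> \<open>Written as a difference so that the closure rule for differences
    applies.\<close>
  have neg': "AE r in lebesgue_on {0..T}. ((\<lambda>r. 0 - r) has_real_derivative -1) (at r within {0..T})"
    by (auto intro!: derivative_eq_intros)
  have "AE r in lebesgue_on {0..T}. f' r \<le> 1" "AE r in lebesgue_on {0..T}. -1 \<le> f' r"
    using bd by (eventually_elim, simp)+
  then have "f t - f 0 \<le> t - 0" "(0 - t) - (0 - 0) \<le> f t - f 0"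
    using t by (intro ae_derivative_le_imp_increment_le[OF lip _ f' id']
        ae_derivative_le_imp_increment_le[OF _ lip neg' f'] lipschitzian_on_intros; simp)+
  then show ?thesis using \<open>f 0 = 0\<close> by simp
qed

text \<open>After multiplication by the sign \<sigma> the function has slope at most 1 yet gains
  \<open>T\<close> in time \<open>T\<close>. Time lost anywhere cannot be made up, so it is the
  identity.\<close>

lemma maximal_speed:
  fixes f :: "real \<Rightarrow> real"
  assumes lip: "lipschitzian_on {0..T} f" and "f 0 = 0" and "T > 0"
    and f': "AE r in lebesgue_on {0..T}. (f has_real_derivative f' r) (at r within {0..T})"
    and bd: "AE r in lebesgue_on {0..T}. \<bar>f' r\<bar> \<le> 1"
    and fT: "f T = \<sigma> * T" "\<bar>\<sigma>\<bar> = 1"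
  shows "AE r in lebesgue_on {0..T}. f' r = \<sigma>"
proof -
  define g where "g = (\<lambda>t. \<sigma> * f t)"
  have \<sigma>: "\<sigma> * \<sigma> = 1" using fT(2) by (metis abs_mult_self_eq mult_1)
  have lipg: "lipschitzian_on {0..T} g"
    unfolding g_def by (intro lipschitzian_on_intros lip)
  have g': "AE r in lebesgue_on {0..T}. (g has_real_derivative \<sigma> * f' r) (at r within {0..T})"
    using f' unfolding g_def by eventually_elim (rule DERIV_cmult)
  have le: "AE r in lebesgue_on {0..T}. \<sigma> * f' r \<le> 1"
    using bd
  proof eventually_elim
    case (elim r)
    have "\<bar>\<sigma> * f' r\<bar> \<le> 1" using elim fT(2) by (simp add: abs_mult)
    then show ?case by simp
  qed
  have id': "AE r in lebesgue_on {0..T}. ((\<lambda>r. r) has_real_derivative 1) (at r within {0..T})"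
    by simp
  note inc = ae_derivative_le_imp_increment_le[OF lipg lipschitzian_on_id g' id' le]
  have g0: "g 0 = 0" "g T = T"
    using \<open>f 0 = 0\<close> fT(1) \<sigma> by (simp_all add: g_def mult.assoc[symmetric])
  \<comment> \<open>The increment over \<open>{0..t}\<close> bounds \<open>g t\<close> from above,
    the one over \<open>{t..T}\<close> from below.\<close>
  have g: "g t = 1 * t" if "t \<in> {0..T}" for t
    using inc[of 0 t] inc[of t T] that g0 by simp
  show ?thesis
    using g' AE_lebesgue_on_mem
  proof eventually_elim
    case (elim r)
    then have "\<sigma> * f' r = 1"
      using derivative_unique_if_linear[OF elim(1) \<open>T > 0\<close> elim(2) g] by simp
    then have "\<sigma> * \<sigma> * f' r = \<sigma>" by (simp add: mult.assoc)
    then show ?case using \<sigma> by simp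
  qed
qed

section \<open>Horizontal lifts of radial plane curves\<close>

text \<open>The endpoint of the horizontal lift of the segment from the origin to
  \<open>(x, y)\<close>: integrating the equations for \<open>z\<close>, \<open>v\<close>,
  \<open>w\<close> along it gives these entries.\<close>

definition abnormal_point :: "real \<Rightarrow> real \<Rightarrow> M" where
  "abnormal_point x y = (x, y, 0, y * (x\<^sup>2 + y\<^sup>2) / 6, - (x * (x\<^sup>2 + y\<^sup>2) / 6))"

lemma abnormal_point_simps [simp]:
  "fst (abnormal_point x y) = x" "fst (snd (abnormal_point x y)) = y" "abnormal_point 0 0 = 0"
  by (simp_all add: abnormal_point_def zero_prod_def)

text \<open>Curves with the same plane projection and the same control have the same velocity, so
  uniqueness of solutions reduces to uniqueness of antiderivatives.\<close>

lemma X12_cong: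
  assumes "fst p = fst q" "fst (snd p) = fst (snd q)"
  shows "X1 p = X1 q" "X2 p = X2 q"
  using assms by (simp_all add: X_alt)

text \<open>When the plane velocity is parallel to the position, the \<open>z\<close> component
  \<open>(x * b - y * a) / 2\<close> vanishes, and replacing \<open>y * a\<close> by
  \<open>x * b\<close> turns the derivatives of the two cubic entries into the required
  ones.\<close>

lemma has_vector_derivative_abnormal_point:
  assumes x': "(x has_real_derivative a) (at t within S)"
    and y': "(y has_real_derivative b) (at t within S)"
    and radial: "x t * b = y t * a"
  shows "((\<lambda>t. abnormal_point (x t) (y t)) has_vector_derivative
      a *\<^sub>R X1 (abnormal_point (x t) (y t)) + b *\<^sub>R X2 (abnormal_point (x t) (y t))) (at t within S)"
proof -
  have v: "((\<lambda>t. y t * ((x t)\<^sup>2 + (y t)\<^sup>2) / 6) has_real_derivative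
      b * ((x t)\<^sup>2 + (y t)\<^sup>2) / 2) (at t within S)"
  proof (rule DERIV_cong)
    show "((\<lambda>t. y t * ((x t)\<^sup>2 + (y t)\<^sup>2) / 6) has_real_derivative
      (b * ((x t)\<^sup>2 + (y t)\<^sup>2) + y t * (2 * x t * a + 2 * y t * b)) / 6) (at t within S)"
      by (auto intro!: derivative_eq_intros x' y' simp: algebra_simps)
    have "y t * (2 * x t * a + 2 * y t * b) = 2 * x t * (y t * a) + 2 * (y t)\<^sup>2 * b"
      by (simp add: algebra_simps power2_eq_square)
    then show "(b * ((x t)\<^sup>2 + (y t)\<^sup>2) + y t * (2 * x t * a + 2 * y t * b)) / 6 =
        b * ((x t)\<^sup>2 + (y t)\<^sup>2) / 2"
      using radial by (auto simp: algebra_simps power2_eq_square)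
  qed
  have w: "((\<lambda>t. - (x t * ((x t)\<^sup>2 + (y t)\<^sup>2) / 6)) has_real_derivative
      - (a * ((x t)\<^sup>2 + (y t)\<^sup>2) / 2)) (at t within S)"
  proof (rule DERIV_cong)
    show "((\<lambda>t. - (x t * ((x t)\<^sup>2 + (y t)\<^sup>2) / 6)) has_real_derivative
      - ((a * ((x t)\<^sup>2 + (y t)\<^sup>2) + x t * (2 * x t * a + 2 * y t * b)) / 6)) (at t within S)"
      by (auto intro!: derivative_eq_intros x' y' simp: algebra_simps)
    have "x t * (2 * x t * a + 2 * y t * b) = 2 * (x t)\<^sup>2 * a + 2 * y t * (x t * b)"
      by (simp add: algebra_simps power2_eq_square)
    then show "- ((a * ((x t)\<^sup>2 + (y t)\<^sup>2) + x t * (2 * x t * a + 2 * y t * b)) / 6) =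
        - (a * ((x t)\<^sup>2 + (y t)\<^sup>2) / 2)"
      using radial by (auto simp: algebra_simps power2_eq_square)
  qed
  have "((\<lambda>t. abnormal_point (x t) (y t)) has_vector_derivative
      (a, b, 0, b * ((x t)\<^sup>2 + (y t)\<^sup>2) / 2, - (a * ((x t)\<^sup>2 + (y t)\<^sup>2) / 2))) (at t within S)"
    unfolding abnormal_point_def
    using x' y' v w
    by (intro has_vector_derivative_Pair)
       (auto simp: has_real_derivative_iff_has_vector_derivative)
  moreover have "(a, b, 0, b * ((x t)\<^sup>2 + (y t)\<^sup>2) / 2, - (a * ((x t)\<^sup>2 + (y t)\<^sup>2) / 2)) =
      a *\<^sub>R X1 (abnormal_point (x t) (y t)) + b *\<^sub>R X2 (abnormal_point (x t) (y t))"
    using radial by (auto simp: X_alt algebra_simps)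
  ultimately show ?thesis by simp
qed

lemma lipschitzian_on_abnormal_point:
  fixes x y :: "real \<Rightarrow> real"
  assumes "lipschitzian_on {a..b} x" "lipschitzian_on {a..b} y"
  shows "lipschitzian_on {a..b} (\<lambda>t. abnormal_point (x t) (y t))"
proof -
  \<comment> \<open>Squares, the quotient and the negation are rewritten with products and a
    difference to fit the closure rules.\<close>
  have "lipschitzian_on {a..b} (\<lambda>t. (x t, y t, 0::real,
      y t * (x t * x t + y t * y t) * (1/6), 0 - x t * (x t * x t + y t * y t) * (1/6)))"
    by (intro lipschitzian_on_intros assms)
  then show ?thesis by (simp add: abnormal_point_def power2_eq_square)
qed

section \<open>Horizontal curves whose control lies in a line\<close>

definition horizontal :: "real \<Rightarrow> (real \<Rightarrow> real \<times> real) \<Rightarrow> (real \<Rightarrow> M) \<Rightarrow> bool" where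
  "horizontal T u q \<longleftrightarrow> q 0 = 0 \<and> lipschitzian_on {0..T} q \<and>
     (AE t in lebesgue_on {0..T}.
        (q has_vector_derivative fst (u t) *\<^sub>R X1 (q t) + snd (u t) *\<^sub>R X2 (q t))
          (at t within {0..T}))"

lemma trajectory_iff: "trajectory T u q \<longleftrightarrow> admissible_control T u \<and> horizontal T u q"
  by (auto simp: trajectory_def horizontal_def lipschitzian_on_def)

lemma horizontal_xy:
  assumes "horizontal T u q"
  shows "fst (q 0) = 0" "fst (snd (q 0)) = 0"
    "lipschitzian_on {0..T} (\<lambda>t. fst (q t))" "lipschitzian_on {0..T} (\<lambda>t. fst (snd (q t)))"
    "AE t in lebesgue_on {0..T}. ((\<lambda>t. fst (q t)) has_real_derivative fst (u t)) (at t within {0..T})"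
    "AE t in lebesgue_on {0..T}. ((\<lambda>t. fst (snd (q t))) has_real_derivative snd (u t)) (at t within {0..T})"
proof -
  have q: "lipschitzian_on {0..T} q" "AE t in lebesgue_on {0..T}.
        (q has_vector_derivative fst (u t) *\<^sub>R X1 (q t) + snd (u t) *\<^sub>R X2 (q t))
          (at t within {0..T})" "q 0 = 0"
    using assms by (auto simp: horizontal_def)
  show "fst (q 0) = 0" "fst (snd (q 0)) = 0" using q(3) by simp_all
  show "lipschitzian_on {0..T} (\<lambda>t. fst (q t))" "lipschitzian_on {0..T} (\<lambda>t. fst (snd (q t)))"
    by (intro lipschitzian_on_intros q)+
  show "AE t in lebesgue_on {0..T}. ((\<lambda>t. fst (q t)) has_real_derivative fst (u t)) (at t within {0..T})"
    using q(2)
  proof eventually_elim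
    case (elim t)
    then show ?case
      using bounded_linear.has_vector_derivative[OF bounded_linear_fst elim]
      by (simp add: has_real_derivative_iff_has_vector_derivative X_alt)
  qed
  show "AE t in lebesgue_on {0..T}. ((\<lambda>t. fst (snd (q t))) has_real_derivative snd (u t)) (at t within {0..T})"
    using q(2)
  proof eventually_elim
    case (elim t)
    then show ?case
      using bounded_linear.has_vector_derivative[OF bounded_linear_fst
          bounded_linear.has_vector_derivative[OF bounded_linear_snd elim]]
      by (simp add: has_real_derivative_iff_has_vector_derivative X_alt)
  qed
qed

text \<open>The combination \<open>m * x + n * y\<close> has derivative zero and starts at zero, so
  position and velocity in the plane are parallel. The lift of the projection then solves the same
  equation as \<open>q\<close>.\<close>

lemma horizontal_in_line:
  assumes hor: "horizontal T u q" and n: "(m, n) \<noteq> (0, 0)"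
    and u: "AE t in lebesgue_on {0..T}. m * fst (u t) + n * snd (u t) = 0"
    and t: "t \<in> {0..T}"
  shows "m * fst (q t) + n * fst (snd (q t)) = 0"
    and "q t = abnormal_point (fst (q t)) (fst (snd (q t)))"
proof -
  note xy = horizontal_xy[OF hor]
  have line: "m * fst (q t) + n * fst (snd (q t)) = 0" if "t \<in> {0..T}" for t
  proof -
    have "AE t in lebesgue_on {0..T}.
        ((\<lambda>t. m * fst (q t) + n * fst (snd (q t))) has_vector_derivative 0) (at t within {0..T})"
      using xy(5,6) u
    proof eventually_elim
      case (elim t)
      show ?case
        using DERIV_add[OF DERIV_cmult[OF elim(1), of m] DERIV_cmult[OF elim(2), of n]] elim(3)
        by (simp add: has_real_derivative_iff_has_vector_derivative)
    qed
    moreover have "lipschitzian_on {0..T} (\<lambda>t. m * fst (q t) + n * fst (snd (q t)))"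
      by (intro lipschitzian_on_intros xy)
    ultimately have "m * fst (q t) + n * fst (snd (q t)) = m * fst (q 0) + n * fst (snd (q 0))"
      using that by (intro ae_derivative_zero_imp_constant[where a=0 and b=T])
    then show ?thesis using xy(1,2) by simp
  qed
  show "m * fst (q t) + n * fst (snd (q t)) = 0" using line t .
  \<comment> \<open>Two vectors orthogonal to the nonzero \<open>(m, n)\<close> have determinant
    zero: its products with \<open>m\<close> and with \<open>n\<close> both vanish.\<close>
  have radial: "x * b = y * a" if "m * x + n * y = 0" "m * a + n * b = 0" for x y a b :: real
  proof -
    have "m * (x * b - y * a) = b * (m * x + n * y) - y * (m * a + n * b)"
      "n * (x * b - y * a) = x * (m * a + n * b) - a * (m * x + n * y)"
      by (simp_all add: algebra_simps)
    then show ?thesis using that n by auto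
  qed
  let ?e = "\<lambda>t. abnormal_point (fst (q t)) (fst (snd (q t)))"
  have e': "AE t in lebesgue_on {0..T}.
      (?e has_vector_derivative fst (u t) *\<^sub>R X1 (q t) + snd (u t) *\<^sub>R X2 (q t)) (at t within {0..T})"
    using xy(5,6) u AE_lebesgue_on_mem
  proof eventually_elim
    case (elim t)
    have "fst (q t) * snd (u t) = fst (snd (q t)) * fst (u t)"
      using radial line[OF elim(4)] elim(3) .
    from has_vector_derivative_abnormal_point[OF elim(1,2) this]
    show ?case using X12_cong[of "?e t" "q t"] by simp
  qed
  have elip: "lipschitzian_on {0..T} ?e"
    by (intro lipschitzian_on_abnormal_point xy)
  have e0: "q 0 = ?e 0" using hor by (simp add: horizontal_def)
  have hq: "lipschitzian_on {0..T} q" and hq': "AE t in lebesgue_on {0..T}.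
      (q has_vector_derivative fst (u t) *\<^sub>R X1 (q t) + snd (u t) *\<^sub>R X2 (q t)) (at t within {0..T})"
    using hor by (auto simp: horizontal_def)
  show "q t = ?e t"
    by (rule ae_derivative_eq_imp_eq[OF hq elip e0 hq' e' _ t]) simp
qed

lemma horizontal_constant_control:
  assumes hor: "horizontal T u q" and u: "AE t in lebesgue_on {0..T}. u t = c"
    and t: "t \<in> {0..T}"
  shows "q t = abnormal_point (fst c * t) (snd c * t)"
proof -
  note xy = horizontal_xy[OF hor]
  have x: "fst (q t) = fst c * t"
  proof (rule ae_derivative_eq_imp_eq[where a=0 and b=T and f = "\<lambda>t. fst (q t)"
        and g = "\<lambda>t. fst c * t" and f' = "\<lambda>t. fst (u t)" and g' = "\<lambda>_. fst c"])
    show "AE r in lebesgue_on {0..T}. ((*) (fst c) has_vector_derivative fst c) (at r within {0..T})"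
      by (auto intro!: derivative_eq_intros simp flip: has_real_derivative_iff_has_vector_derivative)
    show "AE r in lebesgue_on {0..T}. fst (u r) = fst c"
      using u by eventually_elim simp
  qed (use xy t in \<open>auto intro!: lipschitzian_on_intros simp: has_real_derivative_iff_has_vector_derivative\<close>)
  have y: "fst (snd (q t)) = snd c * t"
  proof (rule ae_derivative_eq_imp_eq[where a=0 and b=T and f = "\<lambda>t. fst (snd (q t))"
        and g = "\<lambda>t. snd c * t" and f' = "\<lambda>t. snd (u t)" and g' = "\<lambda>_. snd c"])
    show "AE r in lebesgue_on {0..T}. ((*) (snd c) has_vector_derivative snd c) (at r within {0..T})"
      by (auto intro!: derivative_eq_intros simp flip: has_real_derivative_iff_has_vector_derivative)
    show "AE r in lebesgue_on {0..T}. snd (u r) = snd c"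
      using u by eventually_elim simp
  qed (use xy t in \<open>auto intro!: lipschitzian_on_intros simp: has_real_derivative_iff_has_vector_derivative\<close>)
  \<comment> \<open>A normal to \<open>c\<close>; for \<open>c = 0\<close> every nonzero vector is
    one, and \<open>(1, 0)\<close> is taken.\<close>
  obtain m n where mn: "(m, n) \<noteq> (0, 0)" "m * fst c + n * snd c = 0"
  proof (cases "c = 0")
    case True
    then show ?thesis using that[of 1 0] by simp
  next
    case False
    then show ?thesis using that[of "- snd c" "fst c"] by (auto simp: prod_eq_iff)
  qed
  have "AE t in lebesgue_on {0..T}. m * fst (u t) + n * snd (u t) = 0"
    using u by eventually_elim (simp add: mn(2))
  from horizontal_in_line(2)[OF hor mn(1) this t] x y show ?thesis by simp
qed

text \<open>The lifted ray is a solution. For uniqueness, the first two coordinates of the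
  difference of two solutions have zero derivative; hence the fields agree along both, and the whole
  difference is constant.\<close>

lemma time_one_flow_constant:
  "time_one_flow (\<lambda>q. a *\<^sub>R X1 q + b *\<^sub>R X2 q) 0 = abnormal_point a b"
  unfolding time_one_flow_def
proof (rule the_equality)
  let ?e = "\<lambda>t. abnormal_point (a * t) (b * t)"
  have e': "(?e has_vector_derivative a *\<^sub>R X1 (?e t) + b *\<^sub>R X2 (?e t)) (at t within S)" for t S
    by (rule has_vector_derivative_abnormal_point) (auto intro!: derivative_eq_intros)
  then show "\<exists>\<gamma>. \<gamma> 0 = 0 \<and> \<gamma> 1 = abnormal_point a b \<and>
      (\<forall>t\<in>{0..1}. (\<gamma> has_vector_derivative a *\<^sub>R X1 (\<gamma> t) + b *\<^sub>R X2 (\<gamma> t)) (at t within {0..1}))"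
    by (intro exI[of _ ?e]) simp
  fix q
  assume "\<exists>\<gamma>. \<gamma> 0 = 0 \<and> \<gamma> 1 = q \<and>
      (\<forall>t\<in>{0..1}. (\<gamma> has_vector_derivative a *\<^sub>R X1 (\<gamma> t) + b *\<^sub>R X2 (\<gamma> t)) (at t within {0..1}))"
  then obtain \<gamma> where \<gamma>: "\<gamma> 0 = 0" "\<gamma> 1 = q" and
    \<gamma>': "\<And>t. t \<in> {0..1} \<Longrightarrow> (\<gamma> has_vector_derivative a *\<^sub>R X1 (\<gamma> t) + b *\<^sub>R X2 (\<gamma> t)) (at t within {0..1})"
    by blast
  let ?d = "\<lambda>t. \<gamma> t - ?e t"
  have d': "(?d has_vector_derivative a *\<^sub>R (X1 (\<gamma> t) - X1 (?e t)) + b *\<^sub>R (X2 (\<gamma> t) - X2 (?e t)))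
      (at t within {0..1})" if "t \<in> {0..1}" for t
    using has_vector_derivative_diff[OF \<gamma>'[OF that] e'] by (simp add: algebra_simps)
  \<comment> \<open>Kept polymorphic in the range: it serves for single coordinates and for the
    difference in \<open>M\<close>.\<close>
  have zero: "f t = 0" if z: "t \<in> {0..1}" "f 0 = 0"
    "\<And>t. t \<in> {0..1} \<Longrightarrow> (f has_vector_derivative 0) (at t within {0..1})"
    for f :: "real \<Rightarrow> 'z::real_normed_vector" and t
  proof -
    obtain c where "\<And>t. t \<in> {0..1} \<Longrightarrow> f t = c"
      using has_vector_derivative_zero_constant[of "{0..1}" f] z(3) by auto
    from this[OF z(1)] this[of 0] z(2) show ?thesis by simp
  qed
  have "fst (?d t) = 0" if "t \<in> {0..1}" for t
    by (rule zero[OF that]) (use bounded_linear.has_vector_derivative[OF bounded_linear_fst d']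
        in \<open>auto simp: \<gamma>(1) X_alt\<close>)
  moreover have "fst (snd (?d t)) = 0" if "t \<in> {0..1}" for t
    by (rule zero[OF that]) (use bounded_linear.has_vector_derivative[OF bounded_linear_fst
          bounded_linear.has_vector_derivative[OF bounded_linear_snd d']]
        in \<open>auto simp: \<gamma>(1) X_alt\<close>)
  ultimately have "(?d has_vector_derivative 0) (at t within {0..1})" if "t \<in> {0..1}" for t
    using d'[OF that] X12_cong[of "\<gamma> t" "?e t"] that by simp
  then have "?d 1 = 0"
    by (rule zero[rotated 2]) (simp_all add: \<gamma>(1))
  then show "q = abnormal_point a b" by (simp add: \<gamma>(2))
qed

lemma abnormal_manifold_eq: "abnormal_manifold = {abnormal_point x y | x y. True}"
  by (simp add: abnormal_manifold_def time_one_flow_constant)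

section \<open>Abnormal extremals confine the control to a line\<close>

lemma abnormal_imp_control_in_line:
  assumes "abnormal T u q" and T: "T > 0"
  obtains m n where "(m, n) \<noteq> (0, 0)"
    "AE t in lebesgue_on {0..T}. m * fst (u t) + n * snd (u t) = 0"
proof -
  obtain \<xi> where \<xi>: "extremal T u q \<xi> 0"
    using assms(1) by (auto simp: abnormal_def)
  have lip: "lipschitzian_on {0..T} \<xi>"
    and ham: "AE t in lebesgue_on {0..T}.
        (\<xi> has_vector_derivative
           fst (u t) *\<^sub>R hamiltonian_field (momentum X1) (\<xi> t) +
           snd (u t) *\<^sub>R hamiltonian_field (momentum X2) (\<xi> t)) (at t within {0..T})"
    and p0: "\<And>t. t \<in> {0..T} \<Longrightarrow> snd (\<xi> t) \<noteq> 0"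
    and H0: "\<And>t. t \<in> {0..T} \<Longrightarrow> max_hamiltonian (\<xi> t) = 0"
    using \<xi> by (simp_all add: extremal_def lipschitzian_on_def)
  \<comment> \<open>The form \<open>0 * t\<close> matches
    \<open>derivative_unique_if_linear\<close>.\<close>
  have h1: "momentum X1 (\<xi> t) = 0 * t" and h2: "momentum X2 (\<xi> t) = 0 * t" if "t \<in> {0..T}" for t
    using H0[OF that] by (simp_all add: max_hamiltonian_def)
  define h3 h4 h5 where h: "h3 = (\<lambda>t. momentum X3 (\<xi> t))" "h4 = (\<lambda>t. momentum X4 (\<xi> t))"
    "h5 = (\<lambda>t. momentum X5 (\<xi> t))"
  have alt: "momentum X (\<xi> t) = momentum X (fst (\<xi> t), snd (\<xi> t))" for X t
    by simp
  have lip_h: "lipschitzian_on {0..T} h3" "lipschitzian_on {0..T} h4" "lipschitzian_on {0..T} h5"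
    unfolding h alt momentum_alt by (intro lipschitzian_on_intros lip)+
  have ae: "AE t in lebesgue_on {0..T}. fst (u t) * h3 t = 0 \<and> snd (u t) * h3 t = 0 \<and>
      (h3 has_real_derivative fst (u t) * h4 t + snd (u t) * h5 t) (at t within {0..T}) \<and>
      (h4 has_vector_derivative 0) (at t within {0..T}) \<and>
      (h5 has_vector_derivative 0) (at t within {0..T})"
    using ham AE_lebesgue_on_mem
  proof eventually_elim
    case (elim t)
    note sys = hamiltonian_system[OF elim(1)]
    have "- snd (u t) * momentum X3 (\<xi> t) = 0"
      by (rule derivative_unique_if_linear[OF sys(2) T elim(2) h1])
    moreover have "fst (u t) * momentum X3 (\<xi> t) = 0"
      by (rule derivative_unique_if_linear[OF sys(3) T elim(2) h2])
    ultimately show ?case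
      using sys(4-6) by (simp add: h has_real_derivative_iff_has_vector_derivative)
  qed
  have h4: "h4 t = h4 0" and h5: "h5 t = h5 0" if "t \<in> {0..T}" for t
  proof -
    have "AE t in lebesgue_on {0..T}. (h4 has_vector_derivative 0) (at t within {0..T})"
      "AE t in lebesgue_on {0..T}. (h5 has_vector_derivative 0) (at t within {0..T})"
      using ae by (eventually_elim, simp)+
    then show "h4 t = h4 0" "h5 t = h5 0"
      using lip_h that by (auto intro: ae_derivative_zero_imp_constant)
  qed
  have "AE t in lebesgue_on {0..T}. ((\<lambda>t. h3 t * h3 t) has_vector_derivative 0) (at t within {0..T})"
    using ae
  proof eventually_elim
    case (elim t)
    let ?d = "fst (u t) * h4 t + snd (u t) * h5 t"
    have "?d * h3 t = h4 t * (fst (u t) * h3 t) + h5 t * (snd (u t) * h3 t)"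
      by (simp add: algebra_simps)
    then have zero: "?d * h3 t = 0" using elim by simp
    have "((\<lambda>t. h3 t * h3 t) has_real_derivative ?d * h3 t + ?d * h3 t) (at t within {0..T})"
      using elim by (intro DERIV_mult) simp_all
    then show ?case
      unfolding zero by (simp add: has_real_derivative_iff_has_vector_derivative)
  qed
  then have sq: "h3 t * h3 t = h3 0 * h3 0" if "t \<in> {0..T}" for t
    using lip_h(1) that by (intro ae_derivative_zero_imp_constant[where a=0 and b=T] lipschitzian_on_intros)
  show thesis
  proof (cases "h3 0 = 0")
    case True
    then have h3: "h3 t = 0 * t" if "t \<in> {0..T}" for t
      using sq[OF that] by simp
    \<comment> \<open>Otherwise all five momenta vanish at time 0, and a covector that annihilates
      the whole frame is zero.\<close>
    have "(h4 0, h5 0) \<noteq> (0, 0)"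
    proof
      assume "(h4 0, h5 0) = (0, 0)"
      then have "snd (\<xi> 0) = 0"
        using True h1[of 0] h2[of 0] T unfolding h alt momentum_alt by (simp add: prod_eq_iff)
      then show False using p0[of 0] T by simp
    qed
    moreover have "AE t in lebesgue_on {0..T}. h4 0 * fst (u t) + h5 0 * snd (u t) = 0"
      using ae AE_lebesgue_on_mem
    proof eventually_elim
      case (elim t)
      have "fst (u t) * h4 t + snd (u t) * h5 t = 0"
        using derivative_unique_if_linear[OF _ T elim(2) h3] elim(1) by blast
      then show ?case using h4[OF elim(2)] h5[OF elim(2)] by (simp add: mult.commute)
    qed
    ultimately show thesis by (rule that)
  next
    case False
    \<comment> \<open>The control vanishes almost everywhere here, so any line contains it; the
      normal \<open>(1, 0)\<close> is an arbitrary choice.\<close>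
    have "AE t in lebesgue_on {0..T}. 1 * fst (u t) + 0 * snd (u t) = 0"
      using ae AE_lebesgue_on_mem
    proof eventually_elim
      case (elim t)
      then have "h3 t \<noteq> 0" using sq[OF elim(2)] False by auto
      then show ?case using elim(1) by simp
    qed
    then show thesis by (rule that[rotated]) simp
  qed
qed

section \<open>Time bounds and constant controls\<close>

lemma admissible_control_bound:
  assumes "admissible_control T u" "t \<in> {0..T}"
  shows "\<bar>fst (u t)\<bar> \<le> 1" "\<bar>snd (u t)\<bar> \<le> 1"
proof -
  have "max \<bar>fst (u t)\<bar> \<bar>snd (u t)\<bar> \<le> 1"
    using assms by (simp add: admissible_control_def flip: infnorm_eq_max)
  then show "\<bar>fst (u t)\<bar> \<le> 1" "\<bar>snd (u t)\<bar> \<le> 1" by simp_all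
qed

text \<open>Both plane coordinates move at speed at most one. The resulting lower bound on travel
  time is the basis of every optimality argument below.\<close>

lemma trajectory_bound:
  assumes "trajectory T u q" and t: "t \<in> {0..T}"
  shows "\<bar>fst (q t)\<bar> \<le> t" "\<bar>fst (snd (q t))\<bar> \<le> t"
proof -
  have adm: "admissible_control T u" and hor: "horizontal T u q"
    using assms(1) by (auto simp: trajectory_iff)
  note xy = horizontal_xy[OF hor]
  have "AE t in lebesgue_on {0..T}. \<bar>fst (u t)\<bar> \<le> 1" "AE t in lebesgue_on {0..T}. \<bar>snd (u t)\<bar> \<le> 1"
    using AE_lebesgue_on_mem by (eventually_elim, simp add: admissible_control_bound[OF adm])+
  then show "\<bar>fst (q t)\<bar> \<le> t" "\<bar>fst (snd (q t))\<bar> \<le> t"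
    using speed_bound[OF xy(3,1,5) _ t] speed_bound[OF xy(4,2,6) _ t] by auto
qed

lemma admissible_constant_control:
  assumes "0 \<le> T" "infnorm c \<le> 1"
  shows "admissible_control T (\<lambda>_. c)"
  using assms by (simp add: admissible_control_def)

lemma constant_control_trajectory:
  assumes adm: "admissible_control T u" and u: "AE t in lebesgue_on {0..T}. u t = c"
  shows "trajectory T u (\<lambda>t. abnormal_point (fst c * t) (snd c * t))"
  unfolding trajectory_iff horizontal_def
proof (intro conjI adm)
  show "lipschitzian_on {0..T} (\<lambda>t. abnormal_point (fst c * t) (snd c * t))"
    by (intro lipschitzian_on_abnormal_point lipschitzian_on_intros)
  let ?e = "\<lambda>t. abnormal_point (fst c * t) (snd c * t)"
  show "AE t in lebesgue_on {0..T}.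
      (?e has_vector_derivative fst (u t) *\<^sub>R X1 (?e t) + snd (u t) *\<^sub>R X2 (?e t)) (at t within {0..T})"
    using u
  proof eventually_elim
    case (elim t)
    show ?case
      unfolding elim
      by (rule has_vector_derivative_abnormal_point) (auto intro!: derivative_eq_intros)
  qed
qed simp

text \<open>One component of \<open>c\<close> has absolute value 1, so the matching coordinate of
  the endpoint has absolute value \<open>T\<close>, which no trajectory reaches sooner.\<close>

lemma constant_control_optimal:
  assumes q: "trajectory T u q" and u: "AE t in lebesgue_on {0..T}. u t = c" and c: "infnorm c = 1"
  shows "optimal T u q"
  unfolding optimal_def
proof (intro conjI q notI)
  assume "\<exists>T' u' q'. T' < T \<and> trajectory T' u' q' \<and> q' T' = q T"
  then obtain T' u' q' where q': "T' < T" "trajectory T' u' q'" "q' T' = q T" by blast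
  have "0 \<le> T'" using q'(2) by (simp add: trajectory_def admissible_control_def)
  have "q T = abnormal_point (fst c * T) (snd c * T)"
    using horizontal_constant_control[OF _ u, of q T] q \<open>0 \<le> T'\<close> q'(1) by (simp add: trajectory_iff)
  then have "\<bar>fst c * T\<bar> \<le> T'" "\<bar>snd c * T\<bar> \<le> T'"
    using trajectory_bound[OF q'(2), of T'] \<open>0 \<le> T'\<close> q'(3) by simp_all
  moreover have "\<bar>fst c\<bar> = 1 \<or> \<bar>snd c\<bar> = 1"
    using c infnorm_eq_max[of "fst c" "snd c"] by (auto simp: max_def split: if_splits)
  ultimately show False using q'(1) \<open>0 \<le> T'\<close> by (auto simp: abs_mult)
qed

text \<open>An explicit covector along the lifted ray annihilates \<open>X1\<close> and
  \<open>X2\<close>, which makes the maximum condition trivial; there remains the adjoint equation.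
  It is nonzero because \<open>c\<close> is.\<close>

lemma constant_control_abnormal:
  assumes adm: "admissible_control T u" and u: "AE t in lebesgue_on {0..T}. u t = c" and c: "c \<noteq> 0"
  shows "abnormal T u (\<lambda>t. abnormal_point (fst c * t) (snd c * t))"
  unfolding abnormal_def
proof (intro conjI exI)
  let ?e = "\<lambda>t. abnormal_point (fst c * t) (snd c * t)"
  define K where "K = (fst c)\<^sup>2 + (snd c)\<^sup>2"
  \<comment> \<open>\<open>(h\<^sub>4, h\<^sub>5) \<bottom> c\<close> and \<open>h\<^sub>3 = 0\<close>; the first two entries then solve \<open>h\<^sub>1 = h\<^sub>2 = 0\<close>.\<close>
  define p :: "real \<Rightarrow> M" where
    "p = (\<lambda>t. (fst c * K / 2 * (t * t), snd c * K / 2 * (t * t), 0, - snd c, fst c))"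
  show tr: "trajectory T u ?e"
    using adm u by (rule constant_control_trajectory)
  have h: "momentum X1 (?e t, p t) = 0" "momentum X2 (?e t, p t) = 0" for t
    by (simp_all add: momentum_alt p_def K_def field_simps power2_eq_square)
  have p0: "p t \<noteq> 0" for t
    using c by (auto simp: p_def prod_eq_iff)
  have H: "max_hamiltonian (?e t, p t) = 0" for t
    by (simp add: max_hamiltonian_def h)
  have lip: "lipschitzian_on {0..T} (\<lambda>t. (?e t, p t))"
    unfolding p_def
    by (intro lipschitzian_on_intros lipschitzian_on_abnormal_point)
  have p': "(p has_vector_derivative (fst c * K * t, snd c * K * t, 0, 0, 0)) (at t within S)" for t S
    unfolding p_def
    by (intro has_vector_derivative_Pair has_vector_derivative_const)
      (auto intro!: derivative_eq_intros simp flip: has_real_derivative_iff_has_vector_derivative)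
  have "AE t in lebesgue_on {0..T}. ((\<lambda>t. (?e t, p t)) has_vector_derivative
      fst (u t) *\<^sub>R hamiltonian_field (momentum X1) (?e t, p t) +
      snd (u t) *\<^sub>R hamiltonian_field (momentum X2) (?e t, p t)) (at t within {0..T})"
    using u tr[unfolded trajectory_def, THEN conjunct2, THEN conjunct2, THEN conjunct2]
  proof eventually_elim
    case (elim t)
    have "fst (u t) *\<^sub>R hamiltonian_field (momentum X1) (?e t, p t) +
        snd (u t) *\<^sub>R hamiltonian_field (momentum X2) (?e t, p t) =
        (fst (u t) *\<^sub>R X1 (?e t) + snd (u t) *\<^sub>R X2 (?e t), (fst c * K * t, snd c * K * t, 0, 0, 0))"
      by (simp add: hamiltonian_field_momentum p_def K_def elim(1) algebra_simps power2_eq_square)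
    then show ?case using has_vector_derivative_Pair[OF elim(2) p'] by simp
  qed
  then show "extremal T u ?e (\<lambda>t. (?e t, p t)) 0"
    using adm lip unfolding extremal_def lipschitzian_on_def
    by (simp add: h H p0)
qed

text \<open>Polar decomposition for the maximum norm: the radius becomes the travel time, the
  direction the constant control.\<close>

lemma exists_unit_direction:
  fixes x y :: real
  obtains c where "infnorm c = 1" "x = fst c * infnorm (x, y)" "y = snd c * infnorm (x, y)"
proof (cases "infnorm (x, y) = 0")
  case True
  \<comment> \<open>At the origin every unit vector qualifies.\<close>
  then show ?thesis using that[of "(1, 1)"] by (simp add: infnorm_eq_max infnorm_eq_0 prod_eq_iff)
next
  case False
  let ?c = "(x / infnorm (x, y), y / infnorm (x, y))"
  have "?c = inverse (infnorm (x, y)) *\<^sub>R (x, y)"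
    by (simp add: field_simps)
  then have "infnorm ?c = 1"
    using False infnorm_pos_le[of "(x, y)"] by (simp only: infnorm_mul) simp
  then show ?thesis using that[of ?c] False by simp
qed

section \<open>Rigidity of optimal controls\<close>

text \<open>The direction \<open>c\<close> of the endpoint yields a constant competitor, which
  forces the travel time to be \<open>infnorm\<close> of the projected endpoint. A component with
  absolute value 1 in \<open>c\<close> is then constant in \<open>u\<close>, and the line determines
  the other one.\<close>

lemma optimal_in_line_imp_constant:
  assumes opt: "optimal T u q" and mn: "(m, n) \<noteq> (0, 0)" and T: "T > 0"
    and u: "AE t in lebesgue_on {0..T}. m * fst (u t) + n * snd (u t) = 0"
  shows "unit_constant_control T u"
proof -
  have adm: "admissible_control T u" and hor: "horizontal T u q"
    using opt by (auto simp: optimal_def trajectory_iff)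
  have tr: "trajectory T u q" using opt by (simp add: optimal_def)
  note xy = horizontal_xy[OF hor]
  let ?x = "fst (q T)" and ?y = "fst (snd (q T))"
  define \<tau> where "\<tau> = infnorm (?x, ?y)"
  obtain c where c: "infnorm c = 1" "?x = fst c * \<tau>" "?y = snd c * \<tau>"
    by (rule exists_unit_direction[of ?x ?y, folded \<tau>_def])
  have "0 \<le> \<tau>" by (simp add: \<tau>_def infnorm_pos_le)
  have line: "m * ?x + n * ?y = 0" "q T = abnormal_point ?x ?y"
    using T by (intro horizontal_in_line[OF hor mn u]; simp)+
  have "\<tau> = T"
  proof (rule antisym)
    show "\<tau> \<le> T"
      using trajectory_bound[OF tr, of T] T by (simp add: \<tau>_def infnorm_eq_max)
    have "trajectory \<tau> (\<lambda>_. c) (\<lambda>t. abnormal_point (fst c * t) (snd c * t))"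
      using \<open>0 \<le> \<tau>\<close> c(1) by (intro constant_control_trajectory admissible_constant_control) simp_all
    then show "T \<le> \<tau>"
      using opt line(2)[unfolded c(2,3)] unfolding optimal_def by (metis not_less)
  qed
  have bound: "AE t in lebesgue_on {0..T}. \<bar>fst (u t)\<bar> \<le> 1" "AE t in lebesgue_on {0..T}. \<bar>snd (u t)\<bar> \<le> 1"
    using AE_lebesgue_on_mem by (eventually_elim, simp add: admissible_control_bound[OF adm])+
  \<comment> \<open>The projected endpoint \<open>T * c\<close> lies in the line, so
    \<open>c\<close> obeys the same linear constraint as the control.\<close>
  have "T * (m * fst c + n * snd c) = 0"
    using line(1) c(2,3) \<open>\<tau> = T\<close> by (simp add: algebra_simps)
  then have mc: "m * fst c + n * snd c = 0" using T by simp
  have "AE t in lebesgue_on {0..T}. u t = c"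
  proof (cases "\<bar>fst c\<bar> = 1")
    case True
    \<comment> \<open>With \<open>n = 0\<close> the constraint on \<open>c\<close> would give
      \<open>m = 0\<close> too. Hence the first component of the control determines the
      second.\<close>
    have "n \<noteq> 0" using mn mc True by auto
    have "AE t in lebesgue_on {0..T}. fst (u t) = fst c"
      using maximal_speed[OF xy(3,1) T xy(5) bound(1)] c(2) True \<open>\<tau> = T\<close> by simp
    then show ?thesis
      using u
    proof eventually_elim
      case (elim t)
      then have "m * fst c + n * snd (u t) = 0" by simp
      with mc have "n * snd (u t) = n * snd c" by linarith
      then show ?case using \<open>n \<noteq> 0\<close> elim(1) by (simp add: prod_eq_iff)
    qed
  next
    case False
    then have c2: "\<bar>snd c\<bar> = 1"
      using c(1) infnorm_eq_max[of "fst c" "snd c"] by (auto simp: max_def split: if_splits)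
    have "m \<noteq> 0" using mn mc c2 by auto
    have "AE t in lebesgue_on {0..T}. snd (u t) = snd c"
      using maximal_speed[OF xy(4,2) T xy(6) bound(2)] c(3) c2 \<open>\<tau> = T\<close> by simp
    then show ?thesis
      using u
    proof eventually_elim
      case (elim t)
      then have "m * fst (u t) + n * snd c = 0" by simp
      with mc have "m * fst (u t) = m * fst c" by linarith
      then show ?case using \<open>m \<noteq> 0\<close> elim(1) by (simp add: prod_eq_iff)
    qed
  qed
  then show ?thesis using adm c(1) unfolding unit_constant_control_def by blast
qed

text \<open>The two assumptions may come with different trajectories; the line constraint speaks of
  the control alone and so passes from one to the other.\<close>

lemma optimal_abnormal_imp_unit_constant_control:
  assumes "optimal_control T u" "abnormal_control T u"
  shows "unit_constant_control T u"
proof -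
  obtain q q' where opt: "optimal T u q" and abn: "abnormal T u q'"
    using assms by (auto simp: optimal_control_def abnormal_control_def)
  have adm: "admissible_control T u" using opt by (simp add: optimal_def trajectory_def)
  show ?thesis
  proof (cases "T > 0")
    case True
    then show ?thesis
      using abnormal_imp_control_in_line[OF abn True] optimal_in_line_imp_constant[OF opt] by metis
  next
    case False
    with adm have "T = 0" by (simp add: admissible_control_def)
    \<comment> \<open>The interval \<open>{0..0}\<close> is a null set, so any unit vector would
      serve as the constant.\<close>
    then have "AE t in lebesgue_on {0..T}. u t = (1, 1)"
      by (intro AE_I'[of "{0}"]) (auto simp: null_sets_restrict_space negligible_iff_null_sets[symmetric])
    moreover have "infnorm (1::real, 1::real) = 1" by (simp add: infnorm_eq_max)
    ultimately show ?thesis using adm unfolding unit_constant_control_def by blast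
  qed
qed

section \<open>One-parameter subgroups\<close>

lemma one_parameter_subgroup_abnormal_point:
  "one_parameter_subgroup (\<lambda>t. abnormal_point (a * t) (b * t))"
  unfolding one_parameter_subgroup_def
proof (intro conjI allI)
  define K where "K = a\<^sup>2 + b\<^sup>2"
  \<comment> \<open>The successive derivatives: the curve is polynomial of degree at most three, so
    they vanish from order four on.\<close>
  define D :: "nat \<Rightarrow> real \<Rightarrow> M" where "D = (\<lambda>n t.
    if n = 0 then abnormal_point (a * t) (b * t)
    else if n = 1 then (a, b, 0, b * K / 2 * t\<^sup>2, - (a * K / 2 * t\<^sup>2))
    else if n = 2 then (0, 0, 0, b * K * t, - (a * K * t))
    else if n = 3 then (0, 0, 0, b * K, - (a * K)) else 0)"
  have D0: "D 0 = (\<lambda>t. abnormal_point (a * t) (b * t))" by (simp add: D_def)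
  have *: "(\<lambda>t. abnormal_point (a * t) (b * t)) =
      (\<lambda>t. (a * t, b * t, 0, b * K / 6 * t ^ 3, - (a * K / 6 * t ^ 3)))"
    by (simp add: abnormal_point_def K_def fun_eq_iff power2_eq_square power3_eq_cube field_simps)
  have D': "(D n has_vector_derivative D (Suc n) t) (at t)" for n t
  proof -
    consider "n = 0" | "n = 1" | "n = 2" | "n \<ge> 3" by linarith
    then show ?thesis
    proof cases
      case 1
      have "((\<lambda>t. abnormal_point (a * t) (b * t)) has_vector_derivative
          (a, b, 0, b * K / 2 * t\<^sup>2, - (a * K / 2 * t\<^sup>2))) (at t)"
        unfolding * by (intro has_vector_derivative_Pair has_vector_derivative_const)
          (auto intro!: derivative_eq_intros simp flip: has_real_derivative_iff_has_vector_derivative)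
      with 1 show ?thesis by (simp add: D_def)
    next
      case 2
      have "((\<lambda>t. (a, b, 0::real, b * K / 2 * t\<^sup>2, - (a * K / 2 * t\<^sup>2))) has_vector_derivative
          (0, 0, 0, b * K * t, - (a * K * t))) (at t)"
        by (intro has_vector_derivative_Pair has_vector_derivative_const)
          (auto intro!: derivative_eq_intros simp flip: has_real_derivative_iff_has_vector_derivative)
      with 2 show ?thesis by (simp add: D_def)
    next
      case 3
      have "((\<lambda>t. (0::real, 0::real, 0::real, b * K * t, - (a * K * t))) has_vector_derivative
          (0, 0, 0, b * K, - (a * K))) (at t)"
        by (intro has_vector_derivative_Pair has_vector_derivative_const)
          (auto intro!: derivative_eq_intros simp flip: has_real_derivative_iff_has_vector_derivative)
      with 3 show ?thesis by (simp add: D_def)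
    next
      case 4
      then show ?thesis by (cases "n = 3") (simp_all add: D_def)
    qed
  qed
  show "smooth_curve (\<lambda>t. abnormal_point (a * t) (b * t))"
    unfolding smooth_curve_def using D0 D' by blast
  show "abnormal_point (a * (s + t)) (b * (s + t)) =
      cartan_mult (abnormal_point (a * s) (b * s)) (abnormal_point (a * t) (b * t))" for s t
    by (simp add: abnormal_point_def field_simps power2_eq_square)
qed

lemma tangent_to_distribution_abnormal_point:
  "tangent_to_distribution (\<lambda>t. abnormal_point (a * t) (b * t))"
  unfolding tangent_to_distribution_def
proof
  fix t
  let ?q = "abnormal_point (a * t) (b * t)"
  have "a *\<^sub>R X1 ?q + b *\<^sub>R X2 ?q \<in> distribution ?q"
    unfolding distribution_def by (intro span_add span_scale span_base) simp_all
  moreover have "((\<lambda>t. abnormal_point (a * t) (b * t)) has_vector_derivative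
      a *\<^sub>R X1 ?q + b *\<^sub>R X2 ?q) (at t)"
    by (rule has_vector_derivative_abnormal_point) (auto intro!: derivative_eq_intros)
  ultimately show "\<exists>D\<in>distribution ?q.
      ((\<lambda>t. abnormal_point (a * t) (b * t)) has_vector_derivative D) (at t)"
    by blast
qed

theorem theorem3:
  shows
    "(\<forall>T u. optimal_control T u \<and> abnormal_control T u \<longrightarrow> unit_constant_control T u) \<and>
     (\<forall>T u. unit_constant_control T u \<longrightarrow> optimal_control T u \<and> abnormal_control T u) \<and>
     abnormal_manifold =
       {(x, y, z, v, w). z = 0 \<and> v = y * (x\<^sup>2 + y\<^sup>2) / 6 \<and> w = - (x * (x\<^sup>2 + y\<^sup>2) / 6)} \<and>
     (\<forall>T u q. unit_constant_control T u \<and> trajectory T u q \<longrightarrow>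
        (\<forall>t \<in> {0..T}. q t \<in> abnormal_manifold)) \<and>
     (\<forall>q\<^sub>1 \<in> abnormal_manifold. \<exists>T u q.
        unit_constant_control T u \<and> optimal T u q \<and> q T = q\<^sub>1) \<and>
     (\<forall>T u q. optimal T u q \<and> abnormal T u q \<longrightarrow>
        (\<exists>\<gamma>. one_parameter_subgroup \<gamma> \<and> tangent_to_distribution \<gamma> \<and>
           (\<forall>t \<in> {0..T}. q t = \<gamma> t)) \<and>
        collinear ((\<lambda>t. (fst (q t), fst (snd (q t)))) ` {0..T}))"
proof (intro conjI allI impI ballI)
  fix T u assume "optimal_control T u \<and> abnormal_control T u"
  then show "unit_constant_control T u"
    using optimal_abnormal_imp_unit_constant_control by blast
next
  fix T u assume "unit_constant_control T u"
  then obtain c where adm: "admissible_control T u" and c: "infnorm c = 1"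
    and u: "AE t in lebesgue_on {0..T}. u t = c"
    by (auto simp: unit_constant_control_def)
  show "optimal_control T u"
    using constant_control_optimal[OF constant_control_trajectory[OF adm u] u c]
    by (auto simp: optimal_control_def)
  have "c \<noteq> 0" using c by (metis infnorm_0 zero_neq_one)
  then show "abnormal_control T u"
    using constant_control_abnormal[OF adm u] by (auto simp: abnormal_control_def)
next
  show "abnormal_manifold =
      {(x, y, z, v, w). z = 0 \<and> v = y * (x\<^sup>2 + y\<^sup>2) / 6 \<and> w = - (x * (x\<^sup>2 + y\<^sup>2) / 6)}"
    by (auto simp: abnormal_manifold_eq abnormal_point_def)
next
  fix T u q t
  assume "unit_constant_control T u \<and> trajectory T u q" and t: "t \<in> {0..T}"
  then obtain c where "horizontal T u q" "AE t in lebesgue_on {0..T}. u t = c"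
    by (auto simp: unit_constant_control_def trajectory_iff)
  then show "q t \<in> abnormal_manifold"
    using horizontal_constant_control[OF _ _ t] unfolding abnormal_manifold_eq by blast
next
  fix q\<^sub>1 assume "q\<^sub>1 \<in> abnormal_manifold"
  then obtain x y where q1: "q\<^sub>1 = abnormal_point x y" by (auto simp: abnormal_manifold_eq)
  \<comment> \<open>The optimal arrival time; it is 0 for the identity, where the direction below is
    arbitrary.\<close>
  define \<tau> where "\<tau> = infnorm (x, y)"
  obtain c where c: "infnorm c = 1" "x = fst c * \<tau>" "y = snd c * \<tau>"
    by (rule exists_unit_direction[of x y, folded \<tau>_def])
  have adm: "admissible_control \<tau> (\<lambda>_. c)"
    using c(1) by (intro admissible_constant_control) (simp_all add: \<tau>_def infnorm_pos_le)
  have "optimal \<tau> (\<lambda>_. c) (\<lambda>t. abnormal_point (fst c * t) (snd c * t))"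
    using constant_control_optimal[OF constant_control_trajectory[OF adm] _ c(1)] by simp
  moreover have "unit_constant_control \<tau> (\<lambda>_. c)"
    using adm c(1) unfolding unit_constant_control_def by (intro conjI exI[of _ c]) simp_all
  ultimately show "\<exists>T u q. unit_constant_control T u \<and> optimal T u q \<and> q T = q\<^sub>1"
    using c(2,3) q1 by blast
next
  fix T u q assume "optimal T u q \<and> abnormal T u q"
  then have opt: "optimal T u q" and "unit_constant_control T u"
    using optimal_abnormal_imp_unit_constant_control
    by (auto simp: optimal_control_def abnormal_control_def)
  then obtain c where "horizontal T u q" "AE t in lebesgue_on {0..T}. u t = c"
    by (auto simp: unit_constant_control_def optimal_def trajectory_iff)
  note q = horizontal_constant_control[OF this]
  show "\<exists>\<gamma>. one_parameter_subgroup \<gamma> \<and> tangent_to_distribution \<gamma> \<and> (\<forall>t \<in> {0..T}. q t = \<gamma> t)"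
    using q one_parameter_subgroup_abnormal_point tangent_to_distribution_abnormal_point by blast
  show "collinear ((\<lambda>t. (fst (q t), fst (snd (q t)))) ` {0..T})"
    unfolding collinear_def
  \<comment> \<open>The projection at time \<open>t\<close> is \<open>t\<close> times
    \<open>c\<close>, so \<open>c\<close> directs the line.\<close>
  proof (intro exI[of _ c] ballI)
    fix p p'
    assume "p \<in> (\<lambda>t. (fst (q t), fst (snd (q t)))) ` {0..T}"
      "p' \<in> (\<lambda>t. (fst (q t), fst (snd (q t)))) ` {0..T}"
    then obtain s t where "s \<in> {0..T}" "t \<in> {0..T}"
      "p = (fst (q s), fst (snd (q s)))" "p' = (fst (q t), fst (snd (q t)))"
      by blast
    then have "p - p' = (s - t) *\<^sub>R c"
      using q by (simp add: prod_eq_iff algebra_simps)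
    then show "\<exists>r. p - p' = r *\<^sub>R c" ..
  qed
qed

end
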